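(* Let $f=\frac45$, $l=\frac{219}{800}$, $u=\frac{269}{800}$, and let $\pi\colon\mathbb{R}\to\mathbb{R}$ be the $\mathbb{Z}$-periodic piecewise linear function given by the table of breakpoints, values and limits in the context. Then: (i) $\pi$ is a minimal valid function. (ii) $\pi$ cannot be written as a convex combination of piecewise continuous minimal valid functions other than $\pi$. In particular, it cannot be written as a convex combination of piecewise linear minimal valid functions other than $\pi$. (iii) $\pi$ is not extreme, because it admits effective locally microperiodic perturbations. In particular, let $t_1=\frac{77}{7752}\sqrt2$, $t_2=\frac{77}{2584}$, $\langle t_1,t_2\rangle_{\mathbb{Z}}=\mathbb{Z}t_1+\mathbb{Z}t_2$, and let $\bar\pi\colon\mathbb{R}\to\mathbb{R}$ be the $\mathbb{Z}$-periodic function defined for $x\in[0,1)$ by \[\bar\pi(x)=\begin{cases} 1 & \text{if } x\in(l,u) \text{ and } x-l\in\langle t_1,t_2\rangle_{\mathbb{Z}},\ \text{or if } x\in(f-u,f-l) \text{ and } x-f+u\in\langle t_1,t_2\rangle_{\mathbb{Z}};\\ -1 & \text{if } x\in(l,u) \text{ and } x-u\in\langle t_1,t_2\rangle_{\mathbb{Z}},\ \text{or if } x\in(f-u,f-l) \text{ and } x-f+l\in\langle t_1,t_2\rangle_{\mathbb{Z}};\\ 0 & \text{otherwise.} \end{cases}\] Let $\epsilon=0.0003$. Then $\pi+\epsilon\bar\pi$ and $\pi-\epsilon\bar\pi$ are minimal valid functions.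
   Context: Minimal valid functions (with $f=\frac45$): functions $\pi\colon\mathbb{R}\to[0,1]$ that are $\mathbb{Z}$-periodic, subadditive, with $\pi(0)=0$, $\pi(f)=1$, and $\pi(x)+\pi(f-x)=1$ for all $x\in\mathbb{R}$. A minimal valid function is extreme if it cannot be written as a convex combination of two other minimal valid functions. An effective perturbation of $\pi$ is a function $\tilde\pi\colon\mathbb{R}\to\mathbb{R}$ such that $\pi\pm\epsilon\tilde\pi$ are minimal valid for some $\epsilon>0$. For $0=y_0<y_1<\dots<y_n=1$ let $B=\{y_i+t : 0\le i\le n-1,\ t\in\mathbb{Z}\}$, and let $\mathcal{P}_B$ be the complex consisting of the empty face, the singletons $\{x\}$, $x\in B$, and the closed intervals between consecutive points of $B$. A function is piecewise linear (respectively, piecewise continuous) if, for some such $B$, it is affine (respectively, continuous) on the relative interior of each face of $\mathcal{P}_B$; arbitrary discontinuities at the breakpoints are allowed. Locally microperiodic: let $T$ be a finitely generated additive subgroup of $\mathbb{R}$, dense in $\mathbb{R}$. A $\mathbb{Z}$-periodic function that vanishes at all breakpoints of some complex $\mathcal{P}_B$ and that, on the interior of each interval $I\subseteq[0,1]$ of $\mathcal{P}_B$, is constant on each of finitely many cosets $b+T$ (intersected with $\operatorname{int}(I)$), with nonzero constant, and zero elsewhere (with at least one such coset on at least one interval) is called locally microperiodic. Definition of $\pi$. Breakpoints $0=x_0<x_1<\dots<x_{40}=1$ are listed below. Each entry gives $x_i$; the value $\pi(x_i)$; and, where given, the one-sided limits $\pi(x_i^-)=\lim_{x\uparrow x_i}\pi(x)$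 and $\pi(x_i^+)=\lim_{x\downarrow x_i}\pi(x)$. "lim" means that both one-sided limits equal the given number. An omitted limit equals the value. On each open interval $(x_i,x_{i+1})$, $\pi$ is the affine function interpolating $\pi(x_i^+)$ and $\pi(x_{i+1}^-)$ (its slope is one of $c_1=\frac{35}{13}$, $c_2=\frac{5}{11999}$, $c_3=-5$); $\pi$ is extended $\mathbb{Z}$-periodically. - $i=0$: $x=0$; value $0$; lim $\frac{101}{650}$. - $i=1$: $x=\frac{101}{5000}$; value $\frac{2727}{13000}$; lim $\frac{707}{13000}$. - $i=2$: $x=\frac{60153}{369200}$; value $\frac{421071}{959920}$. - $i=3$: $x=\frac{849}{5000}$; value $-\frac{1925}{71994}\sqrt2+\frac{4851099}{11999000}$; lim $\frac{4851099}{11999000}$. - $i=4$: $x=\frac{1925}{298129}\sqrt2+\frac{849}{5000}$; value $\frac{67375}{3875677}\sqrt2+\frac{4851099}{11999000}$. - $i=5$: $x=\frac{77}{7752}\sqrt2+\frac{849}{5000}$; value $\frac{2695}{100776}\sqrt2+\frac{4851099}{11999000}$; lim $\frac{385}{93016248}\sqrt2+\frac{4851099}{11999000}$. - $i=6$: $x=\frac{19}{100}$; value $\frac{18196}{59995}$; lim $-\frac{1925}{71994}\sqrt2+\frac{275183}{599950}$. - $i=7$: $x=\frac{77}{22152}\sqrt2+\frac{281986521}{1490645000}$; value $-\frac{385}{22152}\sqrt2+\frac{10467633}{22933000}$. - $i=8$: $x=\frac{40294}{201875}$; value $\frac{795836841}{1937838500}$; lim $\frac{848837}{2099500}$. - $i=9$: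 $x=\frac{36999}{184600}$; value $\frac{975607}{2399800}$. - $i=10$: $x=\frac{77}{7752}\sqrt2+\frac{19}{100}$; value $\frac{385}{93016248}\sqrt2+\frac{18196}{59995}$; lim $-\frac{385}{7752}\sqrt2+\frac{275183}{599950}$. - $i=11$: $x=\frac{1051}{5000}$; value $-\frac{1925}{71994}\sqrt2+\frac{4291761}{11999000}$; lim $\frac{4291761}{11999000}$. - $i=12$: $x=\frac{1925}{298129}\sqrt2+\frac{1051}{5000}$; value $\frac{67375}{3875677}\sqrt2+\frac{4291761}{11999000}$. - $i=13$: $x=\frac{14199}{64600}$; value $\frac{50943}{167960}$; lim $\frac{192500}{3875677}\sqrt2+\frac{240046061}{775135400}$. - $i=14$: $x=\frac{77}{7752}\sqrt2+\frac{1051}{5000}$; value $\frac{2695}{100776}\sqrt2+\frac{4291761}{11999000}$; lim $\frac{385}{93016248}\sqrt2+\frac{4291761}{11999000}$. - $i=15$: $x=\frac{77}{22152}\sqrt2+\frac{342208579}{1490645000}$; value $-\frac{385}{22152}\sqrt2+\frac{122181831}{298129000}$. - $i=16$: $x=\frac{193799}{807500}$; value $\frac{187742}{524875}$. - $i=17$: $x=l=\frac{219}{800}$; value $\frac{933}{2080}$ (equal to the left limit); $\pi(x^+)=\frac{51443}{147680}$. - $i=18$: $x=u=\frac{269}{800}$; $\pi(x^-)=\frac{668809}{1919840}$; value $\frac{683}{2080}$ (equal to the right limit). - $i=19$: $x=f-u=\frac{371}{800}$; value $\frac{1397}{2080}$ (equal to the left limit); $\pi(x^+)=\frac{1251031}{1919840}$.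 - $i=20$: $x=f-l=\frac{421}{800}$; $\pi(x^-)=\frac{96237}{147680}$; value $\frac{1147}{2080}$ (equal to the right limit). - $i=21$: $x=\frac{452201}{807500}$; value $\frac{337133}{524875}$. - $i=22$: $x=-\frac{77}{22152}\sqrt2+\frac{850307421}{1490645000}$; value $\frac{385}{22152}\sqrt2+\frac{175947169}{298129000}$. - $i=23$: $x=-\frac{77}{7752}\sqrt2+\frac{2949}{5000}$; value $-\frac{2695}{100776}\sqrt2+\frac{7707239}{11999000}$; lim $-\frac{385}{93016248}\sqrt2+\frac{7707239}{11999000}$. - $i=24$: $x=\frac{37481}{64600}$; value $\frac{117017}{167960}$; lim $-\frac{192500}{3875677}\sqrt2+\frac{535089339}{775135400}$. - $i=25$: $x=-\frac{1925}{298129}\sqrt2+\frac{2949}{5000}$; value $-\frac{67375}{3875677}\sqrt2+\frac{7707239}{11999000}$. - $i=26$: $x=\frac{2949}{5000}$; value $\frac{1925}{71994}\sqrt2+\frac{7707239}{11999000}$; lim $\frac{7707239}{11999000}$. - $i=27$: $x=-\frac{77}{7752}\sqrt2+\frac{61}{100}$; value $-\frac{385}{93016248}\sqrt2+\frac{41799}{59995}$; lim $\frac{385}{7752}\sqrt2+\frac{324767}{599950}$. - $i=28$: $x=\frac{110681}{184600}$; value $\frac{1424193}{2399800}$. - $i=29$: $x=\frac{121206}{201875}$; value $\frac{1142001659}{1937838500}$; lim $\frac{1250663}{2099500}$. - $i=30$: $x=-\frac{77}{22152}\sqrt2+\frac{910529479}{1490645000}$; value $\frac{385}{22152}\sqrt2+\frac{12465367}{22933000}$.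 - $i=31$: $x=\frac{61}{100}$; value $\frac{41799}{59995}$; lim $\frac{1925}{71994}\sqrt2+\frac{324767}{599950}$. - $i=32$: $x=-\frac{77}{7752}\sqrt2+\frac{3151}{5000}$; value $-\frac{2695}{100776}\sqrt2+\frac{7147901}{11999000}$; lim $-\frac{385}{93016248}\sqrt2+\frac{7147901}{11999000}$. - $i=33$: $x=-\frac{1925}{298129}\sqrt2+\frac{3151}{5000}$; value $-\frac{67375}{3875677}\sqrt2+\frac{7147901}{11999000}$. - $i=34$: $x=\frac{3151}{5000}$; value $\frac{1925}{71994}\sqrt2+\frac{7147901}{11999000}$; lim $\frac{7147901}{11999000}$. - $i=35$: $x=\frac{235207}{369200}$; value $\frac{538849}{959920}$. - $i=36$: $x=\frac{3899}{5000}$; value $\frac{10273}{13000}$; lim $\frac{12293}{13000}$. - $i=37$: $x=f=\frac45$; value $1$; lim $\frac{549}{650}$. - $i=38$: $x=\frac{4101}{5000}$; value $\frac{9667}{13000}$; lim $\frac{899}{1000}$. - $i=39$: $x=\frac{4899}{5000}$; value $\frac{3333}{13000}$; lim $\frac{101}{1000}$. - $i=40$: $x=1$; value $0$; lim $\frac{101}{650}$. *)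

theory Defs
  imports "HOL-Analysis.Analysis" "HOL-Computational_Algebra.Group_Closure"
begin

definition Z_periodic :: "(real \<Rightarrow> real) \<Rightarrow> bool" where
  "Z_periodic g \<longleftrightarrow> (\<forall>x. \<forall>k::int. g (x + of_int k) = g x)"

definition minimal_valid :: "real \<Rightarrow> (real \<Rightarrow> real) \<Rightarrow> bool" where
  "minimal_valid f g \<longleftrightarrow>
     range g \<subseteq> {0..1} \<and>
     Z_periodic g \<and>
     (\<forall>x y. g (x + y) \<le> g x + g y) \<and>
     g 0 = 0 \<and> g f = 1 \<and>
     (\<forall>x. g x + g (f - x) = 1)"

definition extreme :: "real \<Rightarrow> (real \<Rightarrow> real) \<Rightarrow> bool" where
  "extreme f g \<longleftrightarrow>
     minimal_valid f g \<and>
     \<not> (\<exists>g1 g2 w. minimal_valid f g1 \<and> minimal_valid f g2 \<and> g1 \<noteq> g \<and> g2 \<noteq> g \<and>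
          0 \<le> w \<and> w \<le> 1 \<and> g = (\<lambda>x. w * g1 x + (1 - w) * g2 x))"

text \<open>Convex combinations of finitely many (arbitrarily many) members of a class \<open>C\<close> of
  functions. The library's \<open>convex hull\<close> needs a real vector space, which the function type
  is not an instance of.\<close>

definition convex_combination_of :: "(real \<Rightarrow> real) \<Rightarrow> (real \<Rightarrow> real) set \<Rightarrow> bool" where
  "convex_combination_of g C \<longleftrightarrow>
     (\<exists>(n::nat) (w :: nat \<Rightarrow> real) (h :: nat \<Rightarrow> real \<Rightarrow> real).
        (\<forall>i<n. 0 \<le> w i \<and> h i \<in> C) \<and> (\<Sum>i<n. w i) = 1 \<and>
        g = (\<lambda>x. \<Sum>i<n. w i * h i x))"

definition effective_perturbation :: "real \<Rightarrow> (real \<Rightarrow> real) \<Rightarrow> (real \<Rightarrow> real) \<Rightarrow> bool" where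
  "effective_perturbation f g p \<longleftrightarrow>
     (\<exists>\<epsilon>>0. minimal_valid f (\<lambda>x. g x + \<epsilon> * p x) \<and> minimal_valid f (\<lambda>x. g x - \<epsilon> * p x))"

definition breakpoint_set :: "real set \<Rightarrow> bool" where
  "breakpoint_set B \<longleftrightarrow>
     (\<exists>(n::nat) (y :: nat \<Rightarrow> real). y 0 = 0 \<and> y n = 1 \<and> (\<forall>i<n. y i < y (Suc i)) \<and>
        B = {y i + of_int t | i (t::int). i < n})"

definition interval_faces :: "real set \<Rightarrow> real set set" where
  "interval_faces B = {{a..b} | a b. a \<in> B \<and> b \<in> B \<and> a < b \<and> {a<..<b} \<inter> B = {}}"

definition polyhedral_complex :: "real set \<Rightarrow> real set set" where
  "polyhedral_complex B = {{}} \<union> {{x} | x. x \<in> B} \<union> interval_faces B"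

definition piecewise_linear :: "(real \<Rightarrow> real) \<Rightarrow> bool" where
  "piecewise_linear g \<longleftrightarrow>
     (\<exists>B. breakpoint_set B \<and>
        (\<forall>F \<in> polyhedral_complex B. \<exists>m c. \<forall>x \<in> rel_interior F. g x = m * x + c))"

definition piecewise_continuous :: "(real \<Rightarrow> real) \<Rightarrow> bool" where
  "piecewise_continuous g \<longleftrightarrow>
     (\<exists>B. breakpoint_set B \<and> (\<forall>F \<in> polyhedral_complex B. continuous_on (rel_interior F) g))"

text \<open>In the next definition \<open>T\<close> is the group, \<open>K I\<close> the finite set of cosets of \<open>T\<close> chosen
  on the interval \<open>I\<close>, and \<open>c I A\<close> the nonzero constant taken on the coset \<open>A\<close>.
  Dense subgroups meet every interval, so one chosen coset already makes \<open>p\<close> nonzero.\<close>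

definition locally_microperiodic :: "(real \<Rightarrow> real) \<Rightarrow> bool" where
  "locally_microperiodic p \<longleftrightarrow>
     Z_periodic p \<and>
     (\<exists>T B (K :: real set \<Rightarrow> real set set) (c :: real set \<Rightarrow> real set \<Rightarrow> real).
        (\<exists>S. finite S \<and> T = group_closure S) \<and> closure T = UNIV \<and>
        breakpoint_set B \<and> (\<forall>x \<in> B. p x = 0) \<and>
        (\<forall>I \<in> interval_faces B. I \<subseteq> {0..1} \<longrightarrow>
           finite (K I) \<and> (\<forall>A \<in> K I. \<exists>b. A = (+) b ` T) \<and>
           (\<forall>A \<in> K I. c I A \<noteq> 0 \<and> (\<forall>x \<in> A \<inter> interior I. p x = c I A)) \<and>
           (\<forall>x \<in> interior I - \<Union>(K I). p x = 0)) \<and>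
        (\<exists>I \<in> interval_faces B. I \<subseteq> {0..1} \<and> K I \<noteq> {}))"

text \<open>A row \<open>(x, v\<^sub>-, v, v\<^sub>+)\<close> of a table lists a breakpoint, the limit from the left, the value,
  and the limit from the right.\<close>

type_synonym row = "real \<times> real \<times> real \<times> real"

definition cont_at :: "real \<Rightarrow> real \<Rightarrow> row" where
  "cont_at x v = (x, v, v, v)"

definition lim_at :: "real \<Rightarrow> real \<Rightarrow> real \<Rightarrow> row" where
  "lim_at x v m = (x, m, v, m)"

text \<open>For a table with increasing breakpoints: the tabulated value at a breakpoint, and the
  interpolation of the inner one-sided limits between consecutive breakpoints. The result is
  meaningful only from the first breakpoint to the last.\<close>

fun table_fun :: "row list \<Rightarrow> real \<Rightarrow> real" where
  "table_fun [] x = 0"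
| "table_fun [(a, al, av, ar)] x = av"
| "table_fun ((a, al, av, ar) # (b, bl, bv, br) # rs) x =
     (if x = a then av
      else if x < b then ar + (bl - ar) / (b - a) * (x - a)
      else table_fun ((b, bl, bv, br) # rs) x)"

definition pi_table :: "row list" where
  "pi_table =
    [lim_at (0) (0) (101 / 650),
     lim_at (101 / 5000) (2727 / 13000) (707 / 13000),
     cont_at (60153 / 369200) (421071 / 959920),
     lim_at (849 / 5000) (- (1925 / 71994 * sqrt 2) + 4851099 / 11999000) (4851099 / 11999000),
     cont_at (1925 / 298129 * sqrt 2 + 849 / 5000) (67375 / 3875677 * sqrt 2 + 4851099 / 11999000),
     lim_at (77 / 7752 * sqrt 2 + 849 / 5000) (2695 / 100776 * sqrt 2 + 4851099 / 11999000) (385 / 93016248 * sqrt 2 + 4851099 / 11999000),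
     lim_at (19 / 100) (18196 / 59995) (- (1925 / 71994 * sqrt 2) + 275183 / 599950),
     cont_at (77 / 22152 * sqrt 2 + 281986521 / 1490645000) (- (385 / 22152 * sqrt 2) + 10467633 / 22933000),
     lim_at (40294 / 201875) (795836841 / 1937838500) (848837 / 2099500),
     cont_at (36999 / 184600) (975607 / 2399800),
     lim_at (77 / 7752 * sqrt 2 + 19 / 100) (385 / 93016248 * sqrt 2 + 18196 / 59995) (- (385 / 7752 * sqrt 2) + 275183 / 599950),
     lim_at (1051 / 5000) (- (1925 / 71994 * sqrt 2) + 4291761 / 11999000) (4291761 / 11999000),
     cont_at (1925 / 298129 * sqrt 2 + 1051 / 5000) (67375 / 3875677 * sqrt 2 + 4291761 / 11999000),
     lim_at (14199 / 64600) (50943 / 167960) (192500 / 3875677 * sqrt 2 + 240046061 / 775135400),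
     lim_at (77 / 7752 * sqrt 2 + 1051 / 5000) (2695 / 100776 * sqrt 2 + 4291761 / 11999000) (385 / 93016248 * sqrt 2 + 4291761 / 11999000),
     cont_at (77 / 22152 * sqrt 2 + 342208579 / 1490645000) (- (385 / 22152 * sqrt 2) + 122181831 / 298129000),
     cont_at (193799 / 807500) (187742 / 524875),
     (219 / 800, 933 / 2080, 933 / 2080, 51443 / 147680),
     (269 / 800, 668809 / 1919840, 683 / 2080, 683 / 2080),
     (371 / 800, 1397 / 2080, 1397 / 2080, 1251031 / 1919840),
     (421 / 800, 96237 / 147680, 1147 / 2080, 1147 / 2080),
     cont_at (452201 / 807500) (337133 / 524875),
     cont_at (- (77 / 22152 * sqrt 2) + 850307421 / 1490645000) (385 / 22152 * sqrt 2 + 175947169 / 298129000),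
     lim_at (- (77 / 7752 * sqrt 2) + 2949 / 5000) (- (2695 / 100776 * sqrt 2) + 7707239 / 11999000) (- (385 / 93016248 * sqrt 2) + 7707239 / 11999000),
     lim_at (37481 / 64600) (117017 / 167960) (- (192500 / 3875677 * sqrt 2) + 535089339 / 775135400),
     cont_at (- (1925 / 298129 * sqrt 2) + 2949 / 5000) (- (67375 / 3875677 * sqrt 2) + 7707239 / 11999000),
     lim_at (2949 / 5000) (1925 / 71994 * sqrt 2 + 7707239 / 11999000) (7707239 / 11999000),
     lim_at (- (77 / 7752 * sqrt 2) + 61 / 100) (- (385 / 93016248 * sqrt 2) + 41799 / 59995) (385 / 7752 * sqrt 2 + 324767 / 599950),
     cont_at (110681 / 184600) (1424193 / 2399800),
     lim_at (121206 / 201875) (1142001659 / 1937838500) (1250663 / 2099500),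
     cont_at (- (77 / 22152 * sqrt 2) + 910529479 / 1490645000) (385 / 22152 * sqrt 2 + 12465367 / 22933000),
     lim_at (61 / 100) (41799 / 59995) (1925 / 71994 * sqrt 2 + 324767 / 599950),
     lim_at (- (77 / 7752 * sqrt 2) + 3151 / 5000) (- (2695 / 100776 * sqrt 2) + 7147901 / 11999000) (- (385 / 93016248 * sqrt 2) + 7147901 / 11999000),
     cont_at (- (1925 / 298129 * sqrt 2) + 3151 / 5000) (- (67375 / 3875677 * sqrt 2) + 7147901 / 11999000),
     lim_at (3151 / 5000) (1925 / 71994 * sqrt 2 + 7147901 / 11999000) (7147901 / 11999000),
     cont_at (235207 / 369200) (538849 / 959920),
     lim_at (3899 / 5000) (10273 / 13000) (12293 / 13000),
     lim_at (4 / 5) (1) (549 / 650),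
     lim_at (4101 / 5000) (9667 / 13000) (899 / 1000),
     lim_at (4899 / 5000) (3333 / 13000) (101 / 1000),
     lim_at (1) (0) (101 / 650)]"

definition pi_fun :: "real \<Rightarrow> real" where
  "pi_fun x = table_fun pi_table (frac x)"

end

theory Submission
  imports Defs
begin

text \<open>Put \<open>f = 4/5\<close>. Because \<open>\<pi>(x) + \<pi>(f - x) = 1\<close>, subadditivity of \<open>\<pi>\<close> is the symmetric statement
\<open>\<pi>(x) + \<pi>(y) + \<pi>(z) \<ge> 1\<close> for \<open>x + y + z \<equiv> f\<close> modulo 1. When \<open>x\<close>, \<open>y\<close> and \<open>z\<close> are confined to fixed faces of the
complex, the sum is affine on a polygon, and minimising it is a small linear programme. Its dual says: the
minimum is at least 1 as soon as, for one slope \<open>c\<close>, the lower bounds of \<open>\<pi>(t) - c t\<close> on the three faces add up to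
at least \<open>1 - c (x + y + z)\<close>; and only the three slopes that occur in \<open>\<pi>\<close> are needed. Such bounds make
sense on unions of neighbouring faces as well, so a branch and bound over ranges of faces settles all triples
with about a thousand tests (\<open>refine_correct\<close>). The numbers of the table lie in \<open>\<rat> + \<rat> sqrt 2\<close>; in
integer coordinates with respect to the positive basis \<open>10 - 7 sqrt 2\<close>, \<open>5 sqrt 2 - 7\<close>, addition and sufficiently
many comparisons are componentwise, and the tests become integer arithmetic that is carried out by rewriting.

The same tests still succeed when \<open>\<pi>\<close> is lowered by \<open>\<epsilon> = 0.0003\<close> on the two special intervals \<open>(l, u)\<close> and
\<open>(f - u, f - l)\<close>, with one kind of exception: one variable is one of three points \<open>e\<close> and the other two
lie in \<open>(l, u)\<close>. There \<open>\<pi>\<close> sums to exactly 1. Hence \<open>\<pi> + p\<close> is minimal valid for every \<open>p\<close> bounded by \<open>\<epsilon>\<close> that is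
supported on the special intervals, odd under \<open>x \<mapsto> f - x\<close>, and odd under the reflections \<open>y \<mapsto> f - e - y\<close>
of \<open>(l, u)\<close> (\<open>minimal_valid_perturbed\<close>). The cases \<open>p = 0\<close> and \<open>p = \<plusminus>\<epsilon> \<pi>'\<close>, with \<open>\<pi>'\<close> the microperiodic function,
give all the minimality claims. Composing the reflections gives the translations by \<open>t\<^sub>1\<close> and \<open>t\<^sub>2\<close>, which is why
\<open>\<pi>'\<close> has to be constant on cosets of the dense group that they generate.

For the rigidity claim, let \<open>h\<close> carry positive weight in a convex combination giving \<open>\<pi>\<close>. Wherever \<open>\<pi>\<close> is additive, so
is \<open>h\<close>, hence also \<open>p = h - \<pi>\<close>. Near 0 this makes \<open>p\<close> a bounded solution of Cauchy's equation on intervals, so it is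
linear there, and further relations force the slopes to be 0. Then \<open>p\<close> vanishes near 0, and relations
\<open>\<pi>(e + t) = \<pi>(e) + \<pi>(t)\<close> with \<open>t\<close> near 0 carry this to everything outside the special intervals. Inside \<open>(l, u)\<close>,
\<open>p\<close> is invariant under \<open>t\<^sub>1\<close> and \<open>t\<^sub>2\<close>, so it is constant on dense sets; piecewise continuity makes it constant, and
oddness makes it 0 (\<open>tight_continuous_eq\<close>).\<close>

section \<open>Functions given by tables\<close>

abbreviation abscissa :: "row \<Rightarrow> real" where "abscissa P \<equiv> fst P"
abbreviation left_limit :: "row \<Rightarrow> real" where "left_limit P \<equiv> fst (snd P)"
abbreviation value_there :: "row \<Rightarrow> real" where "value_there P \<equiv> fst (snd (snd P))"
abbreviation right_limit :: "row \<Rightarrow> real" where "right_limit P \<equiv> snd (snd (snd P))"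

definition chord :: "row \<Rightarrow> row \<Rightarrow> real \<Rightarrow> real" where
  "chord P Q x = right_limit P +
     (left_limit Q - right_limit P) / (abscissa Q - abscissa P) * (x - abscissa P)"

abbreviation sorted_rows :: "row list \<Rightarrow> bool" where
  "sorted_rows rs \<equiv> sorted_wrt (\<lambda>P Q. abscissa P < abscissa Q) rs"

lemma table_fun_Cons_Cons:
  "table_fun (P # Q # rs) x =
     (if x = abscissa P then value_there P
      else if x < abscissa Q then chord P Q x else table_fun (Q # rs) x)"
  by (cases P; cases Q) (simp add: chord_def)

lemma table_fun_breakpoint:
  assumes "sorted_rows rs" "P \<in> set rs"
  shows "table_fun rs (abscissa P) = value_there P"
  using assms
proof (induction rs rule: induct_list012)
  case (2 Q)
  then show ?case by (cases Q) auto
next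
  case (3 Q R rs)
  then show ?case
    by (cases "P = Q") (auto simp: table_fun_Cons_Cons simp del: table_fun.simps)
qed simp

lemma table_fun_chord:
  assumes "sorted_rows rs" "Suc i < length rs"
    and "abscissa (rs ! i) < x" "x < abscissa (rs ! Suc i)"
  shows "table_fun rs x = chord (rs ! i) (rs ! Suc i) x"
  using assms
proof (induction rs arbitrary: i rule: induct_list012)
  case (3 P Q rs)
  show ?case
  proof (cases i)
    case 0
    then show ?thesis using 3 by (simp add: table_fun_Cons_Cons del: table_fun.simps)
  next
    case (Suc j)
    have "abscissa Q \<le> abscissa ((Q # rs) ! j)"
      using 3(3,4) Suc by (cases j) (auto intro: less_imp_le)
    then have "abscissa Q < x" "abscissa P < x" using 3(3,5) Suc by auto
    moreover have "table_fun (Q # rs) x = chord ((Q # rs) ! j) ((Q # rs) ! Suc j) x"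
      using 3(2)[of j] 3(3-) Suc by simp
    ultimately show ?thesis
      using Suc by (simp add: table_fun_Cons_Cons del: table_fun.simps)
  qed
qed simp_all

lemma table_position:
  assumes "rs \<noteq> []" "abscissa (rs ! 0) \<le> x" "x \<le> abscissa (last rs)"
  obtains (breakpoint) i where "i < length rs" "x = abscissa (rs ! i)"
    | (between) i where "Suc i < length rs" "abscissa (rs ! i) < x" "x < abscissa (rs ! Suc i)"
proof -
  have "(\<exists>i<length rs. x = abscissa (rs ! i)) \<or>
    (\<exists>i. Suc i < length rs \<and> abscissa (rs ! i) < x \<and> x < abscissa (rs ! Suc i))"
    using assms
  proof (induction rs rule: induct_list012)
    case (2 P)
    then show ?case by auto
  next
    case (3 P Q rs)
    show ?case
    proof (cases "x < abscissa Q")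
      case True
      then show ?thesis using 3(4) by (cases "x = abscissa P") (auto intro!: exI[of _ 0])
    next
      case False
      then have "(\<exists>i<length (Q # rs). x = abscissa ((Q # rs) ! i)) \<or>
        (\<exists>i. Suc i < length (Q # rs) \<and> abscissa ((Q # rs) ! i) < x \<and> x < abscissa ((Q # rs) ! Suc i))"
        using 3 by simp
      then show ?thesis
      proof (elim disjE exE conjE)
        fix i assume "i < length (Q # rs)" "x = abscissa ((Q # rs) ! i)"
        then show ?thesis by (intro disjI1 exI[of _ "Suc i"]) simp
      next
        fix i assume "Suc i < length (Q # rs)" "abscissa ((Q # rs) ! i) < x" "x < abscissa ((Q # rs) ! Suc i)"
        then show ?thesis by (intro disjI2 exI[of _ "Suc i"]) simp
      qed
    qed
  qed simp
  with that show thesis by blast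
qed

definition reflect :: "real \<Rightarrow> row \<Rightarrow> row" where
  "reflect c P = (c - abscissa P, 1 - right_limit P, 1 - value_there P, 1 - left_limit P)"

lemma chord_reflect:
  assumes "abscissa P < abscissa Q"
  shows "chord (reflect c Q) (reflect c P) (c - x) = 1 - chord P Q x"
  using assms by (simp add: chord_def reflect_def field_simps)

lemma sorted_rows_less:
  assumes "sorted_rows rs" "i < length rs" "j < length rs"
  shows "abscissa (rs ! i) < abscissa (rs ! j) \<longleftrightarrow> i < j"
  using assms by (metis linorder_neqE_nat not_less_iff_gr_or_eq sorted_wrt_nth_less)

text \<open>The rows \<open>a..b\<close> form a palindrome up to the point reflection through \<open>(c/2, 1/2)\<close>, and interpolation commutes with
that reflection. A window of rows is needed because the symmetry of \<open>\<pi>\<close> acts separately on \<open>[0, f]\<close> and on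
\<open>[f, 1]\<close>.\<close>

lemma table_fun_reflect:
  assumes rs: "sorted_rows rs" "b < length rs"
    and mirror: "\<And>k. a \<le> k \<Longrightarrow> k \<le> b \<Longrightarrow> rs ! (a + b - k) = reflect c (rs ! k)"
    and x: "abscissa (rs ! a) \<le> x" "x \<le> abscissa (rs ! b)" and ab: "a \<le> b"
  shows "table_fun rs (c - x) = 1 - table_fun rs x"
proof -
  have ne: "rs \<noteq> []" using rs(2) by auto
  have le: "abscissa (rs ! i) \<le> abscissa (rs ! j) \<longleftrightarrow> i \<le> j"
    if "i < length rs" "j < length rs" for i j
    using sorted_rows_less[OF rs(1) that(2,1)] by (simp add: not_less[symmetric])
  have "abscissa (rs ! 0) \<le> x" "x \<le> abscissa (last rs)"
    using le[of 0 a] le[of b "length rs - 1"] rs(2) x ab ne by (auto simp: last_conv_nth)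
  with ne show ?thesis
  proof (cases rule: table_position)
    case (breakpoint i)
    then have i: "a \<le> i" "i \<le> b" using x le[of a i] le[of i b] rs(2) ab by auto
    have "table_fun rs (abscissa (rs ! (a + b - i))) = value_there (rs ! (a + b - i))"
      using i rs(2) by (intro table_fun_breakpoint[OF rs(1)]) auto
    then show ?thesis
      using breakpoint mirror[OF i] table_fun_breakpoint[OF rs(1) nth_mem[OF breakpoint(1)]]
      by (simp add: reflect_def)
  next
    case (between i)
    have "a < Suc i" using sorted_rows_less[OF rs(1), of a "Suc i"] between x(1) rs(2) ab by linarith
    moreover have "i < b" using sorted_rows_less[OF rs(1), of i b] between x(2) rs(2) by linarith
    ultimately have i: "a \<le> i" "Suc i \<le> b" by auto
    let ?j = "a + b - Suc i"
    have j: "rs ! ?j = reflect c (rs ! Suc i)" "rs ! Suc ?j = reflect c (rs ! i)"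
      using i mirror[of "Suc i"] mirror[of i] by (simp_all add: Suc_diff_Suc)
    have "table_fun rs (c - x) = chord (rs ! ?j) (rs ! Suc ?j) (c - x)"
      using between i rs(2) j by (intro table_fun_chord[OF rs(1)]) (simp_all add: reflect_def)
    also have "\<dots> = 1 - chord (rs ! i) (rs ! Suc i) x"
      using j between by (simp add: chord_reflect)
    also have "\<dots> = 1 - table_fun rs x"
      using table_fun_chord[OF rs(1) between] by simp
    finally show ?thesis .
  qed
qed

section \<open>The table in integer coordinates\<close>

text \<open>Every \<open>a + b sqrt 2\<close> is written in the basis \<open>10 - 7 sqrt 2\<close>, \<open>5 sqrt 2 - 7\<close>. The change of basis has
determinant 1, so the coordinates of the table entries, multiplied by a common denominator, are integers. Both
basis elements are positive because \<open>7/5 < sqrt 2 < 10/7\<close>; therefore a componentwise inequality implies an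
inequality of real numbers. The converse fails, but the two bounds on \<open>sqrt 2\<close> are good enough for all the comparisons
that are needed below.\<close>

type_synonym coord = "int \<times> int"

definition denom :: int where "denom = 232540620000"

fun real_of_coord :: "coord \<Rightarrow> real" where
  "real_of_coord (u, v) = (of_int u * (10 - 7 * sqrt 2) + of_int v * (5 * sqrt 2 - 7)) / of_int denom"

fun cadd :: "coord \<Rightarrow> coord \<Rightarrow> coord" where "cadd (a, b) (c, d) = (a + c, b + d)"
fun cle :: "coord \<Rightarrow> coord \<Rightarrow> bool" where "cle (a, b) (c, d) \<longleftrightarrow> a \<le> c \<and> b \<le> d"
fun clt :: "coord \<Rightarrow> coord \<Rightarrow> bool" where "clt (a, b) (c, d) \<longleftrightarrow> a < c \<and> b < d"
fun cmin :: "coord \<Rightarrow> coord \<Rightarrow> coord" where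
  "cmin (a, b) (c, d) = (if a \<le> c then a else c, if b \<le> d then b else d)"
fun cmax :: "coord \<Rightarrow> coord \<Rightarrow> coord" where
  "cmax (a, b) (c, d) = (if a \<le> c then c else a, if b \<le> d then d else b)"
fun ccomb :: "int \<Rightarrow> coord \<Rightarrow> int \<Rightarrow> coord \<Rightarrow> coord" where
  "ccomb m (a, b) n (c, d) = (m * a - n * c, m * b - n * d)"
fun rational_coord :: "int \<Rightarrow> coord" where "rational_coord q = (5 * q, 7 * q)"

lemma coord_basis_pos: "0 < 10 - 7 * sqrt 2" "0 < 5 * sqrt 2 - 7"
proof -
  have "sqrt 2 < 10 / 7" by (rule real_less_lsqrt) (simp_all add: power2_eq_square)
  moreover have "7 / 5 < sqrt 2" by (rule real_less_rsqrt) (simp add: power2_eq_square)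
  ultimately show "0 < 10 - 7 * sqrt 2" "0 < 5 * sqrt 2 - 7" by simp_all
qed

lemma denom_pos: "0 < (of_int denom :: real)" by (simp add: denom_def)

lemma real_of_cadd [simp]: "real_of_coord (cadd a b) = real_of_coord a + real_of_coord b"
  by (cases a; cases b) (simp add: algebra_simps add_divide_distrib diff_divide_distrib)

lemma real_of_ccomb [simp]:
  "real_of_coord (ccomb m a n b) = of_int m * real_of_coord a - of_int n * real_of_coord b"
  by (cases a; cases b) (simp add: algebra_simps add_divide_distrib diff_divide_distrib)

lemma real_of_rational_coord [simp]: "real_of_coord (rational_coord q) = of_int q / of_int denom"
  by (simp add: field_simps)

lemma real_of_coord_mono: "cle a b \<Longrightarrow> real_of_coord a \<le> real_of_coord b"
  using coord_basis_pos denom_pos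
  by (cases a; cases b) (auto intro!: divide_right_mono add_mono mult_right_mono)

lemma real_of_coord_strict_mono: "clt a b \<Longrightarrow> real_of_coord a < real_of_coord b"
  using coord_basis_pos denom_pos
  by (cases a; cases b) (auto intro!: divide_strict_right_mono add_strict_mono mult_strict_right_mono)

lemma real_of_cmin: "real_of_coord (cmin a b) \<le> real_of_coord a" "real_of_coord (cmin a b) \<le> real_of_coord b"
  by (cases a; cases b; auto intro!: real_of_coord_mono simp del: real_of_coord.simps)+

lemma real_of_cmax: "real_of_coord a \<le> real_of_coord (cmax a b)" "real_of_coord b \<le> real_of_coord (cmax a b)"
  by (cases a; cases b; auto intro!: real_of_coord_mono simp del: real_of_coord.simps)+

definition int_table :: "(coord \<times> coord \<times> coord \<times> coord) list" where
  "int_table = [((0, 0), (180666174000, 252932643600), (0, 0), (180666174000, 252932643600)),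
   ((23486602620, 32881243668), (63233160900, 88526425260), (243899334900, 341459068860), (63233160900, 88526425260)),
   ((189436835250, 265211569350), (510022248750, 714031148250), (510022248750, 714031148250), (510022248750, 714031148250)),
   ((197426986380, 276397780932), (470071493100, 658100090340), (426547243100, 595922590340), (470071493100, 658100090340)),
   ((207937486380, 291412780932), (498368993100, 698525090340), (498368993100, 698525090340), (498368993100, 698525090340)),
   ((213595638880, 299495855932), (470078230600, 658109715340), (513602480600, 720287215340), (470078230600, 658109715340)),
   ((220913589000, 309279024600), (489780404000, 684449015600), (352638480000, 493693872000), (489780404000, 684449015600)),
   ((225607638880, 316012355932), (502418230600, 702577215340), (502418230600, 702577215340), (502418230600, 702577215340)),
   ((232074098880, 324903738432), (470085930600, 658120302840), (477502104600, 668502946440), (470085930600, 658120302840)),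
   ((233038201500, 326253482100), (472681591500, 661754228100), (472681591500, 661754228100), (472681591500, 661754228100)),
   ((237082241500, 332377099600), (452461391500, 631136140600), (352645217500, 493703497000), (452461391500, 631136140600)),
   ((244400191620, 342160268268), (415871640900, 582220297260), (372347390900, 520042797260), (415871640900, 582220297260)),
   ((254910691620, 357175268268), (444169140900, 622645297260), (444169140900, 622645297260), (444169140900, 622645297260)),
   ((255560701500, 357784982100), (440919091500, 619596728100), (352652917500, 493714084500), (440919091500, 619596728100)),
   ((260568844120, 365258343268), (415878378400, 582229922260), (459402628400, 644407422260), (415878378400, 582229922260)),
   ((272580844120, 381774843268), (448218378400, 626697422260), (448218378400, 626697422260), (448218378400, 626697422260)),
   ((279047304120, 390666225768), (415886078400, 582240509760), (415886078400, 582240509760), (415886078400, 582240509760)),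
   ((318289973625, 445605963075), (521539419375, 730155187125), (521539419375, 730155187125), (405017169375, 567024037125)),
   ((390958917375, 547342484325), (405047450625, 567066430875), (381791450625, 534508030875), (381791450625, 534508030875)),
   ((539203562625, 754884987675), (780911649375, 1093276309125), (780911649375, 1093276309125), (757655649375, 1060717909125)),
   ((611872506375, 856621508925), (757685930625, 1060760302875), (641163680625, 897629152875), (641163680625, 897629152875)),
   ((651115175880, 911561246232), (746817021600, 1045543830240), (746817021600, 1045543830240), (746817021600, 1045543830240)),
   ((657581635880, 920452628732), (714484721600, 1001086917740), (714484721600, 1001086917740), (714484721600, 1001086917740)),
   ((669593635880, 936969128732), (746824721600, 1045554417740), (703300471600, 983376917740), (746824721600, 1045554417740)),
   ((674601778500, 944442489900), (721784008500, 1008187611900), (810050182500, 1134070255500), (721784008500, 1008187611900)),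
   ((675251788380, 945052203732), (718533959100, 1005139042740), (718533959100, 1005139042740), (718533959100, 1005139042740)),
   ((685762288380, 960067203732), (746831459100, 1045564042740), (790355709100, 1107741542740), (746831459100, 1045564042740)),
   ((693080238500, 969850372400), (710241708500, 996648199400), (810057882500, 1134080843000), (710241708500, 996648199400)),
   ((697124278500, 975973989900), (690021508500, 966030111900), (690021508500, 966030111900), (690021508500, 966030111900)),
   ((698088381120, 977323733568), (692617169400, 969664037160), (685200995400, 959281393560), (692617169400, 969664037160)),
   ((704554841120, 986215116068), (660284869400, 925207124660), (660284869400, 925207124660), (660284869400, 925207124660)),
   ((709248891000, 992948447400), (672922696000, 943335324400), (810064620000, 1134090468000), (672922696000, 943335324400)),
   ((716566841120, 1002731616068), (692624869400, 969674624660), (649100619400, 907497124660), (692624869400, 969674624660)),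
   ((722224993620, 1010814691068), (664334106900, 929259249660), (664334106900, 929259249660), (664334106900, 929259249660)),
   ((732735493620, 1025829691068), (692631606900, 969684249660), (736155856900, 1031861749660), (692631606900, 969684249660)),
   ((740725644750, 1037015902650), (652680851250, 913753191750), (652680851250, 913753191750), (652680851250, 913753191750)),
   ((906675877380, 1269346228332), (1099469939100, 1539257914740), (918803765100, 1286325271140), (1099469939100, 1539257914740)),
   ((930162480000, 1302227472000), (982036926000, 1374851696400), (1162703100000, 1627784340000), (982036926000, 1374851696400)),
   ((953649082620, 1335108715668), (1045270086900, 1463378121660), (864603912900, 1210445478060), (1045270086900, 1463378121660)),
   ((1139216497380, 1594903096332), (117433013100, 164406218340), (298099187100, 417338861940), (117433013100, 164406218340)),
   ((1162703100000, 1627784340000), (180666174000, 252932643600), (0, 0), (180666174000, 252932643600))]"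

fun real_row :: "coord \<times> coord \<times> coord \<times> coord \<Rightarrow> row" where
  "real_row (x, l, v, r) = (real_of_coord x, real_of_coord l, real_of_coord v, real_of_coord r)"

lemma pi_table_eq: "pi_table = map real_row int_table"
  by (simp add: pi_table_def int_table_def lim_at_def cont_at_def denom_def field_simps)

lemma length_int_table: "length int_table = 41"
  by (simp add: int_table_def)

lemma length_pi_table: "length pi_table = 41"
  by (simp add: pi_table_eq length_int_table)

lemma pi_row: "i < 41 \<Longrightarrow> pi_table ! i = real_row (int_table ! i)"
  by (simp add: pi_table_eq length_int_table)

text \<open>Even the order of the breakpoints is visible componentwise.\<close>

lemma sorted_pi_table: "sorted_rows pi_table"
proof -
  have "sorted_wrt (\<lambda>P Q. clt (fst P) (fst Q)) int_table" by code_simp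
  then show ?thesis
    unfolding pi_table_eq sorted_wrt_map
    by (rule sorted_wrt_mono_rel[rotated]) (auto dest: real_of_coord_strict_mono simp del: real_of_coord.simps)
qed

definition breakpt :: "nat \<Rightarrow> real" where "breakpt i = abscissa (pi_table ! i)"
definition breakpt_value :: "nat \<Rightarrow> real" where "breakpt_value i = value_there (pi_table ! i)"

lemma breakpt_mono: "i < 41 \<Longrightarrow> j < 41 \<Longrightarrow> breakpt i < breakpt j \<longleftrightarrow> i < j"
  unfolding breakpt_def using sorted_rows_less[OF sorted_pi_table] by (simp add: length_pi_table)

lemma breakpt_ends: "breakpt 0 = 0" "breakpt 40 = 1"
  by (simp_all add: breakpt_def pi_table_def lim_at_def)

lemma pi_periodic: "pi_fun (x + of_int k) = pi_fun x"
  by (simp add: pi_fun_def frac_add frac_lt_1)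

lemma pi_breakpoint: "i < 41 \<Longrightarrow> pi_fun (breakpt i) = breakpt_value i"
proof -
  assume i: "i < 41"
  have t: "table_fun pi_table (breakpt j) = breakpt_value j" if "j < 41" for j
    using that table_fun_breakpoint[OF sorted_pi_table, of "pi_table ! j"]
    by (simp add: breakpt_def breakpt_value_def length_pi_table)
  have breakpt_value: "breakpt_value 0 = 0" "breakpt_value 40 = 0" by (simp_all add: breakpt_value_def pi_table_def lim_at_def)
  show ?thesis
  proof (cases "i = 40")
    case True
    then show ?thesis using t[of 0] breakpt_value breakpt_ends by (simp add: pi_fun_def)
  next
    case False
    then have "frac (breakpt i) = breakpt i"
      using i breakpt_mono[of i 40] breakpt_mono[of i 0] breakpt_ends by (simp add: frac_eq)
    then show ?thesis using t i by (simp add: pi_fun_def)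
  qed
qed

lemma pi_between:
  assumes "i < 40" "breakpt i < x" "x < breakpt (Suc i)"
  shows "pi_fun x = chord (pi_table ! i) (pi_table ! Suc i) x"
proof -
  have "frac x = x"
    using assms breakpt_mono[of i 0] breakpt_mono[of 40 "Suc i"] breakpt_ends by (simp add: frac_eq)
  then show ?thesis
    using assms table_fun_chord[OF sorted_pi_table, of i x]
    by (simp add: pi_fun_def breakpt_def length_pi_table)
qed

lemma pi_position:
  assumes "0 \<le> x" "x \<le> 1"
  obtains (breakpoint) i where "i < 41" "x = breakpt i"
    | (between) i where "i < 40" "breakpt i < x" "x < breakpt (Suc i)"
proof -
  have "pi_table \<noteq> []" "abscissa (pi_table ! 0) \<le> x" "x \<le> abscissa (last pi_table)"
    using assms by (simp_all add: pi_table_def lim_at_def)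
  then show thesis
    by (cases rule: table_position) (use that in \<open>auto simp: breakpt_def length_pi_table\<close>)
qed

fun creflect :: "int \<Rightarrow> coord \<times> coord \<times> coord \<times> coord \<Rightarrow> coord \<times> coord \<times> coord \<times> coord" where
  "creflect q (x, l, v, r) =
    (ccomb 1 (rational_coord q) 1 x, ccomb 1 (rational_coord denom) 1 r,
     ccomb 1 (rational_coord denom) 1 v, ccomb 1 (rational_coord denom) 1 l)"

lemma real_row_creflect: "real_row (creflect q P) = reflect (of_int q / of_int denom) (real_row P)"
  using denom_pos by (cases P) (simp add: reflect_def del: real_of_coord.simps ccomb.simps rational_coord.simps)

text \<open>The two constants are \<open>4/5\<close> and \<open>9/5\<close> times the common denominator.\<close>

lemma table_mirror:
  "k \<le> 37 \<Longrightarrow> pi_table ! (37 - k) = reflect (4/5) (pi_table ! k)"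
  "37 \<le> k \<Longrightarrow> k \<le> 40 \<Longrightarrow> pi_table ! (77 - k) = reflect (9/5) (pi_table ! k)"
proof -
  have 1: "rev (map (creflect 186032496000) (take 38 int_table)) = take 38 int_table"
    by code_simp
  have 2: "rev (map (creflect 418573116000) (drop 37 int_table)) = drop 37 int_table"
    by code_simp
  show "pi_table ! (37 - k) = reflect (4/5) (pi_table ! k)" if "k \<le> 37"
  proof -
    have "take 38 int_table ! (37 - k) = creflect 186032496000 (int_table ! k)"
      using that by (subst 1[symmetric]) (simp add: rev_nth length_int_table del: creflect.simps)
    then show ?thesis using that real_row_creflect[of 186032496000 "int_table ! k"]
      by (simp add: pi_row denom_def)
  qed
  show "pi_table ! (77 - k) = reflect (9/5) (pi_table ! k)" if "37 \<le> k" "k \<le> 40"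
  proof -
    have "drop 37 int_table ! (40 - k) = creflect 418573116000 (int_table ! k)"
      using that by (subst 2[symmetric]) (simp add: rev_nth length_int_table del: creflect.simps)
    then show ?thesis using that real_row_creflect[of 418573116000 "int_table ! k"]
      by (simp add: pi_row denom_def length_int_table)
  qed
qed

lemma pi_reflect: "pi_fun x + pi_fun (4/5 - x) = 1"
proof -
  define y where "y = frac x"
  have x: "x = y + of_int \<lfloor>x\<rfloor>" by (simp add: y_def frac_def)
  have y: "0 \<le> y" "y < 1" by (auto simp: y_def frac_lt_1)
  have X37: "breakpt 37 = 4/5" by (simp add: breakpt_def pi_table_def lim_at_def)
  have t: "pi_fun z = table_fun pi_table z" if "0 \<le> z" "z < 1" for z
    using that by (simp add: pi_fun_def frac_eq)
  have "pi_fun (4/5 - y) = 1 - pi_fun y"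
  proof (cases "y \<le> 4/5")
    case True
    then have "table_fun pi_table (4/5 - y) = 1 - table_fun pi_table y"
      using y X37 breakpt_ends
      by (intro table_fun_reflect[where a = 0 and b = 37])
        (auto simp: sorted_pi_table length_pi_table table_mirror breakpt_def[symmetric])
    then show ?thesis using True y t by simp
  next
    case False
    then have "table_fun pi_table (9/5 - y) = 1 - table_fun pi_table y"
      using y X37 breakpt_ends
      by (intro table_fun_reflect[where a = 37 and b = 40])
        (auto simp: sorted_pi_table length_pi_table table_mirror breakpt_def[symmetric])
    then show ?thesis
      using False y t[of "9/5 - y"] t[of y] pi_periodic[of "4/5 - y" 1] by (simp add: algebra_simps)
  qed
  then show ?thesis
    using pi_periodic[of y "\<lfloor>x\<rfloor>"] pi_periodic[of "4/5 - y" "- \<lfloor>x\<rfloor>"] x by (simp add: algebra_simps)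
qed

section \<open>Lower bounds on ranges of faces\<close>

text \<open>The faces in \<open>[0, 1]\<close> are numbered from left to right: an even number is a breakpoint, an odd number the open
interval that follows it. The relevant numbers are 1 to 79, because triples with an integer among \<open>x\<close>, \<open>y\<close>, \<open>z\<close> are
trivial; 35 and 39 are the special intervals.\<close>

definition face :: "int \<Rightarrow> real set" where
  "face k = (if even k then {breakpt (nat (k div 2))} else {breakpt (nat (k div 2)) <..< breakpt (Suc (nat (k div 2)))})"

lemma face_exists:
  assumes "0 < x" "x < 1"
  obtains k where "1 \<le> k" "k \<le> 79" "x \<in> face k"
proof -
  have "0 \<le> x" "x \<le> 1" using assms by auto
  then show thesis
  proof (cases rule: pi_position)
    case (breakpoint i)
    then have "i \<noteq> 0" "i \<noteq> 40" using breakpt_ends assms by (metis less_irrefl)+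
    then show thesis using breakpoint by (intro that[of "2 * int i"]) (auto simp: face_def)
  next
    case (between i)
    then show thesis by (intro that[of "2 * int i + 1"]) (auto simp: face_def)
  qed
qed

text \<open>A box describes the graph of a function over a set of real numbers: strictness of the left and right bounds, these two
bounds, and lower bounds for \<open>11999 \<phi>(t) - n t\<close> with \<open>n = 32305, 5, -59995\<close>. The \<open>n/11999\<close> are the slopes \<open>35/13\<close>,
\<open>5/11999\<close> and \<open>-5\<close>.\<close>

datatype box = Box bool bool coord coord coord coord coord

fun join_box :: "box \<Rightarrow> box \<Rightarrow> box" where
  "join_box (Box p1 q1 l1 h1 a1 b1 c1) (Box p2 q2 l2 h2 a2 b2 c2) =
     Box (p1 \<and> p2) (q1 \<and> q2) (cmin l1 l2) (cmax h1 h2)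
       (cmin a1 a2) (cmin b1 b2) (cmin c1 c2)"

text \<open>The amount \<open>0.0003\<close>, in multiples of the reciprocal of the common denominator, by which a perturbation may lower the
function on a special interval.\<close>

definition slack :: "int \<Rightarrow> coord" where
  "slack k = rational_coord (if k = 35 \<or> k = 39 then 69762186 else 0)"

fun slope_bound :: "int \<Rightarrow> int \<Rightarrow> coord \<Rightarrow> coord \<Rightarrow> coord" where
  "slope_bound k n x v = ccomb 11999 (ccomb 1 v 1 (slack k)) n x"

fun point_box :: "int \<Rightarrow> coord \<times> coord \<times> coord \<times> coord \<Rightarrow> box" where
  "point_box k (x, l, v, r) =
     Box False False x x (slope_bound k 32305 x v) (slope_bound k 5 x v) (slope_bound k (-59995) x v)"

fun segment_box where
  "segment_box k (x, l, v, r) (x', l', v', r') =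
     Box True True x x'
       (cmin (slope_bound k 32305 x r) (slope_bound k 32305 x' l'))
       (cmin (slope_bound k 5 x r) (slope_bound k 5 x' l'))
       (cmin (slope_bound k (-59995) x r) (slope_bound k (-59995) x' l'))"

definition row :: "int \<Rightarrow> coord \<times> coord \<times> coord \<times> coord" where
  "row k = int_table ! nat k"

definition face_box :: "int \<Rightarrow> box" where
  "face_box k =
     (if even k then point_box k (row (k div 2))
      else segment_box k (row (k div 2)) (row (k div 2 + 1)))"

function range_box :: "int \<Rightarrow> int \<Rightarrow> box" where
  "range_box i j = (if j \<le> i then face_box i
     else join_box (range_box i ((i + j) div 2)) (range_box ((i + j) div 2 + 1) j))"
  by pat_completeness auto
termination by (relation "Wellfounded.measure (\<lambda>(i, j). nat (j - i))") auto

declare range_box.simps [simp del]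

fun halves :: "int \<times> int \<Rightarrow> (int \<times> int) list" where
  "halves (i, j) = (if j \<le> i then [(i, j)] else [(i, (i + j) div 2), ((i + j) div 2 + 1, j)])"

fun level :: "nat \<Rightarrow> (int \<times> int) list" where
  "level 0 = [(1, 79)]"
| "level (Suc d) = concat (map halves (level d))"

text \<open>From here on, the values of rows, faces and ranges are computed once and kept as rewrite rules. Their right-hand sides
are left to unification, so that the numbers need not be written down. The ranges of a binary subdivision are treated from
the finest level upwards, so that each box is the join of two boxes that are already known.\<close>

lemma rows_listed: "map row [0..40] = int_table"
  by (rule nth_equalityI) (simp_all add: length_int_table row_def nth_upto)

lemma upto_40: "[0..40] = [0, 1, 2, 3, 4, 5, 6, 7, 8, 9, 10, 11, 12, 13, 14, 15, 16, 17, 18, 19, 20, 21, 22, 23, 24, 25, 26, 27, 28, 29, 30, 31, 32, 33, 34, 35, 36, 37, 38, 39, 40 :: int]" by code_simp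
lemma upto_79: "[1..79] = [1, 2, 3, 4, 5, 6, 7, 8, 9, 10, 11, 12, 13, 14, 15, 16, 17, 18, 19, 20, 21, 22, 23, 24, 25, 26, 27, 28, 29, 30, 31, 32, 33, 34, 35, 36, 37, 38, 39, 40, 41, 42, 43, 44, 45, 46, 47, 48, 49, 50, 51, 52, 53, 54, 55, 56, 57, 58, 59, 60, 61, 62, 63, 64, 65, 66, 67, 68, 69, 70, 71, 72, 73, 74, 75, 76, 77, 78, 79 :: int]" by code_simp

lemmas row_values = trans[OF rows_listed int_table_def, unfolded upto_40 list.map list.inject simp_thms]
schematic_goal face_values: "map face_box [1..79] = ?bs"
  by (simp add: upto_79 face_box_def slack_def row_values)

lemmas face_rules = face_values[unfolded upto_79 list.map list.inject simp_thms]

lemma range_box_singleton: "range_box k k = face_box k" by (simp add: range_box.simps)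

schematic_goal level_0: "level 0 = ?L" by simp
schematic_goal level_1: "level (Suc 0) = ?L" by (simp add: eval_nat_numeral level_0)
schematic_goal level_2: "level 2 = ?L" by (simp add: eval_nat_numeral level_1)
schematic_goal level_3: "level 3 = ?L" by (simp add: eval_nat_numeral level_2)
schematic_goal level_4: "level 4 = ?L" by (simp add: eval_nat_numeral level_3)
schematic_goal level_5: "level 5 = ?L" by (simp add: eval_nat_numeral level_4)
schematic_goal level_6: "level 6 = ?L" by (simp add: eval_nat_numeral level_5)

declare face_rules [simp] range_box_singleton [simp]
lemma range_box_split: "i < j \<Longrightarrow> range_box i j = join_box (range_box i ((i + j) div 2)) (range_box ((i + j) div 2 + 1) j)"
  by (simp add: range_box.simps)
schematic_goal map_level_6: "map (\<lambda>(i, j). range_box i j) (level 6) = ?bs"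
  by (simp add: level_6 range_box_split)
lemmas level_values_6 [simp] = map_level_6[unfolded level_6 list.map prod.case list.inject simp_thms]

schematic_goal map_level_5: "map (\<lambda>(i, j). range_box i j) (level 5) = ?bs"
  by (simp add: level_5 range_box_split)
lemmas level_values_5 [simp] = map_level_5[unfolded level_5 list.map prod.case list.inject simp_thms]

schematic_goal map_level_4: "map (\<lambda>(i, j). range_box i j) (level 4) = ?bs"
  by (simp add: level_4 range_box_split)
lemmas level_values_4 [simp] = map_level_4[unfolded level_4 list.map prod.case list.inject simp_thms]

schematic_goal map_level_3: "map (\<lambda>(i, j). range_box i j) (level 3) = ?bs"
  by (simp add: level_3 range_box_split)
lemmas level_values_3 [simp] = map_level_3[unfolded level_3 list.map prod.case list.inject simp_thms]

schematic_goal map_level_2: "map (\<lambda>(i, j). range_box i j) (level 2) = ?bs"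
  by (simp add: level_2 range_box_split)
lemmas level_values_2 [simp] = map_level_2[unfolded level_2 list.map prod.case list.inject simp_thms]

schematic_goal map_level_1: "map (\<lambda>(i, j). range_box i j) (level (Suc 0)) = ?bs"
  by (simp add: level_1 range_box_split)
lemmas level_values_1 [simp] = map_level_1[unfolded level_1 list.map prod.case list.inject simp_thms]

schematic_goal map_level_0: "map (\<lambda>(i, j). range_box i j) (level 0) = ?bs"
  by (simp add: level_0 range_box_split)
lemmas level_values_0 [simp] = map_level_0[unfolded level_0 list.map prod.case list.inject simp_thms]

text \<open>The three tests by slopes are the linear programming bounds; the last two recognise that the plane
\<open>x + y + z = s\<close> does not meet the product of the three ranges, where one open range suffices to turn a strict
comparison into a weak one.\<close>

fun settled :: "coord \<times> coord \<times> coord \<times> coord \<Rightarrow> box \<Rightarrow> box \<Rightarrow> box \<Rightarrow> bool" where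
  "settled (s, ta, tb, tc) (Box p1 q1 l1 h1 a1 b1 c1) (Box p2 q2 l2 h2 a2 b2 c2)
     (Box p3 q3 l3 h3 a3 b3 c3) = 
   (if cle ta (cadd a1 (cadd a2 a3)) then True
    else if cle tb (cadd b1 (cadd b2 b3)) then True
    else if cle tc (cadd c1 (cadd c2 c3)) then True
    else if (if p1 \<or> p2 \<or> p3 then cle else clt) s (cadd l1 (cadd l2 l3)) then True
    else (if q1 \<or> q2 \<or> q3 then cle else clt) (cadd h1 (cadd h2 h3)) s)"

text \<open>For \<open>x + y + z = 4/5 + m\<close>: the coordinates of this number and of \<open>11999 - n (x + y + z)\<close> for the three slopes.\<close>

definition thresholds :: "int \<Rightarrow> coord \<times> coord \<times> coord \<times> coord" where
  "thresholds m = (let s = rational_coord (186032496000 + denom * m); e = rational_coord denom in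
     (s, ccomb 11999 e 32305 s, ccomb 11999 e 5 s, ccomb 11999 e (-59995) s))"

type_synonym triple = "(int \<times> int) \<times> (int \<times> int) \<times> (int \<times> int)"

text \<open>Here \<open>\<pi>\<close> sums to exactly 1 while two of the three points lie in a special interval, so nothing can be subtracted.
A perturbation has to cancel between these two points.\<close>

definition exempt :: "triple \<Rightarrow> bool" where
  "exempt t \<longleftrightarrow> t \<in> {((12, 12), (35, 35), (35, 35)), ((20, 20), (35, 35), (35, 35)), ((26, 26), (35, 35), (35, 35))}"

text \<open>One round of branch and bound. By symmetry only triples of faces in increasing order matter, which settles a triple of
ranges in the wrong order.\<close>

fun refine where 
  "refine T [] = []"
| "refine T (((i1, j1), (i2, j2), (i3, j3)) # ws) =
     (if j2 < i1 then refine T ws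
      else if j3 < i2 then refine T ws
      else if settled T (range_box i1 j1) (range_box i2 j2) (range_box i3 j3) then refine T ws
      else if exempt ((i1, j1), (i2, j2), (i3, j3)) then refine T ws
      else List.product (halves (i1, j1)) (List.product (halves (i2, j2)) (halves (i3, j3))) @ refine T ws)"

schematic_goal thresholds_values: "map thresholds [0, 1, 2] = ?gs"
  by (simp add: thresholds_def denom_def)
lemmas thresholds_rules = thresholds_values[unfolded list.map list.inject simp_thms]

lemma refined_away_2: "(refine (thresholds 2) ^^ 8) [((1, 79), (1, 79), (1, 79))] = []"
  by (simp add: eval_nat_numeral thresholds_rules exempt_def)

text \<open>Seven halvings lead from the whole range to single faces; the eighth round tests the latter.\<close>

lemma refined_away_0: "(refine (thresholds 0) ^^ 8) [((1, 79), (1, 79), (1, 79))] = []"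
  by (simp add: eval_nat_numeral thresholds_rules exempt_def)
lemma refined_away_1: "(refine (thresholds 1) ^^ 8) [((1, 79), (1, 79), (1, 79))] = []"
  by (simp add: eval_nat_numeral thresholds_rules exempt_def)

section \<open>Soundness of the branch and bound\<close>

lemma chord_lower_bound:
  assumes "abscissa P < x" "x < abscissa Q"
    and "m \<le> w * right_limit P - n * abscissa P" "m \<le> w * left_limit Q - n * abscissa Q"
  shows "m \<le> w * chord P Q x - n * x"
proof -
  define t where "t = (x - abscissa P) / (abscissa Q - abscissa P)"
  have t: "0 \<le> t" "t \<le> 1" using assms by (auto simp: t_def)
  have x: "x = abscissa P + t * (abscissa Q - abscissa P)" using assms by (simp add: t_def)
  have c: "chord P Q x = right_limit P + t * (left_limit Q - right_limit P)"
    by (simp add: chord_def t_def)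
  have "m = (1 - t) * m + t * m" by (simp add: algebra_simps)
  also have "\<dots> \<le> (1 - t) * (w * right_limit P - n * abscissa P) + t * (w * left_limit Q - n * abscissa Q)"
    using assms t by (intro add_mono mult_left_mono) auto
  also have "\<dots> = w * (right_limit P + t * (left_limit Q - right_limit P))
      - n * (abscissa P + t * (abscissa Q - abscissa P))"
    by (simp add: algebra_simps)
  also have "\<dots> = w * chord P Q x - n * x"
    by (simp only: c x[symmetric])
  finally show ?thesis .
qed

lemma real_of_slope_bound:
  "real_of_coord (slope_bound k n x v) =
     11999 * (real_of_coord v - real_of_coord (slack k)) - of_int n * real_of_coord x"
  by simp

fun fits :: "(real \<Rightarrow> real) \<Rightarrow> box \<Rightarrow> real \<Rightarrow> bool" where
  "fits \<phi> (Box p q l h a b c) x \<longleftrightarrow>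
     real_of_coord l \<le> x \<and> (p \<longrightarrow> real_of_coord l < x) \<and>
     x \<le> real_of_coord h \<and> (q \<longrightarrow> x < real_of_coord h) \<and>
     real_of_coord a \<le> 11999 * \<phi> x - 32305 * x \<and>
     real_of_coord b \<le> 11999 * \<phi> x - 5 * x \<and>
     real_of_coord c \<le> 11999 * \<phi> x + 59995 * x"

lemma fits_join_box:
  assumes "fits \<phi> A x \<or> fits \<phi> B x"
  shows "fits \<phi> (join_box A B) x"
proof -
  obtain p1 q1 l1 h1 a1 b1 c1 where A: "A = Box p1 q1 l1 h1 a1 b1 c1" by (cases A)
  obtain p2 q2 l2 h2 a2 b2 c2 where B: "B = Box p2 q2 l2 h2 a2 b2 c2" by (cases B)
  show ?thesis
    using assms real_of_cmin[of l1 l2] real_of_cmax(1)[of h1 h2] real_of_cmax(2)[of h2 h1]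
      real_of_cmin[of a1 a2] real_of_cmin[of b1 b2] real_of_cmin[of c1 c2]
    unfolding A B by (auto simp del: real_of_coord.simps)
qed

definition above_slack :: "(real \<Rightarrow> real) \<Rightarrow> bool" where
  "above_slack \<phi> \<longleftrightarrow> (\<forall>k \<in> {1..79}. \<forall>x \<in> face k. pi_fun x - real_of_coord (slack k) \<le> \<phi> x)"

text \<open>On an open face \<open>\<phi>\<close> lies above a chord lowered by the slack, and a chord minus a linear function is bounded below by
its values at the two ends.\<close>

lemma fits_face_box:
  assumes "above_slack \<phi>" and k: "1 \<le> k" "k \<le> 79" and y: "y \<in> face k"
  shows "fits \<phi> (face_box k) y"
proof -
  define i where "i = nat (k div 2)"
  let ?e = "real_of_coord (slack k)"
  have i: "i < 40" using k by (simp add: i_def)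
  have low: "pi_fun y - ?e \<le> \<phi> y" using assms by (simp add: above_slack_def)
  obtain x l v r where P: "row (k div 2) = (x, l, v, r)" by (metis prod_cases4)
  obtain x' l' v' r' where Q: "row (k div 2 + 1) = (x', l', v', r')" by (metis prod_cases4)
  have "nat (k div 2 + 1) = Suc i" using k by (simp add: i_def nat_add_distrib)
  then have rows: "pi_table ! i = real_row (x, l, v, r)" "pi_table ! Suc i = real_row (x', l', v', r')"
    using pi_row[of i] pi_row[of "Suc i"] i P Q by (simp_all add: row_def i_def)
  have breakpt: "breakpt i = real_of_coord x" "breakpt (Suc i) = real_of_coord x'" "breakpt_value i = real_of_coord v"
    by (simp_all add: breakpt_def breakpt_value_def rows)
  show ?thesis
  proof (cases "even k")
    case True
    then have "y = breakpt i" using y by (simp add: face_def i_def)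
    then have "real_of_coord v - ?e \<le> \<phi> y" "y = real_of_coord x"
      using low pi_breakpoint[of i] i breakpt by auto
    then show ?thesis using True
      by (simp add: face_box_def P real_of_slope_bound del: real_of_coord.simps slope_bound.simps)
  next
    case False
    then have yi: "breakpt i < y" "y < breakpt (Suc i)" using y by (simp_all add: face_def i_def)
    have "11999 * chord (pi_table ! i) (pi_table ! Suc i) y - 11999 * ?e \<le> 11999 * \<phi> y"
      using low pi_between[OF i yi] by simp
    moreover have "real_of_coord (cmin (slope_bound k n x r) (slope_bound k n x' l')) + 11999 * ?e
        \<le> 11999 * chord (pi_table ! i) (pi_table ! Suc i) y - of_int n * y" for n
      using yi real_of_cmin[of "slope_bound k n x r" "slope_bound k n x' l'"]
      by (intro chord_lower_bound)
        (auto simp: breakpt_def rows real_of_slope_bound algebra_simps simp del: real_of_coord.simps slope_bound.simps)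
    ultimately have b: "real_of_coord (cmin (slope_bound k n x r) (slope_bound k n x' l'))
        \<le> 11999 * \<phi> y - of_int n * y" for n
      by (smt (verit))
    show ?thesis
      using False yi breakpt b[of 32305] b[of 5] b[of "-59995"]
      by (simp add: face_box_def P Q del: real_of_coord.simps slope_bound.simps)
  qed
qed

lemma fits_range_box:
  assumes "above_slack \<phi>"
  shows "1 \<le> i \<Longrightarrow> j \<le> 79 \<Longrightarrow> i \<le> k \<Longrightarrow> k \<le> j \<Longrightarrow> x \<in> face k \<Longrightarrow> fits \<phi> (range_box i j) x"
proof (induction i j rule: range_box.induct)
  case (1 i j)
  show ?case
  proof (cases "j \<le> i")
    case True
    then have "i = j" "k = i" using 1 by auto
    then show ?thesis using fits_face_box[OF assms, of k x] 1 by (simp add: range_box_singleton)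
  next
    case False
    have "fits \<phi> (range_box i ((i + j) div 2)) x \<or> fits \<phi> (range_box ((i + j) div 2 + 1) j) x"
      using 1 False by (cases "k \<le> (i + j) div 2") auto
    then show ?thesis using False fits_join_box by (simp add: range_box_split)
  qed
qed

text \<open>Weak duality: adding the three bounds for one slope \<open>n/11999\<close> eliminates \<open>x\<close>, \<open>y\<close>, \<open>z\<close> because their sum is known.\<close>

lemma settled_correct:
  assumes ok: "settled (thresholds m) A B C"
    and fits: "fits \<phi> A x" "fits \<phi> B y" "fits \<phi> C z" and sum: "x + y + z = 4/5 + of_int m"
  shows "1 \<le> \<phi> x + \<phi> y + \<phi> z"
proof -
  obtain p1 q1 l1 h1 a1 b1 c1 where A: "A = Box p1 q1 l1 h1 a1 b1 c1" by (cases A)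
  obtain p2 q2 l2 h2 a2 b2 c2 where B: "B = Box p2 q2 l2 h2 a2 b2 c2" by (cases B)
  obtain p3 q3 l3 h3 a3 b3 c3 where C: "C = Box p3 q3 l3 h3 a3 b3 c3" by (cases C)
  obtain s ta tb tc where g: "thresholds m = (s, ta, tb, tc)" by (metis prod_cases4)
  have s: "real_of_coord s = x + y + z"
    and ta: "real_of_coord ta = 11999 - 32305 * (x + y + z)"
    and tb: "real_of_coord tb = 11999 - 5 * (x + y + z)"
    and tc: "real_of_coord tc = 11999 + 59995 * (x + y + z)"
    using g unfolding thresholds_def Let_def sum
    by (auto simp: denom_def add_divide_distrib simp del: real_of_coord.simps rational_coord.simps)
  note f = fits[unfolded A B C fits.simps]
  let ?l = "cadd l1 (cadd l2 l3)" and ?h = "cadd h1 (cadd h2 h3)"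
  have lo: "\<not> (if p1 \<or> p2 \<or> p3 then cle else clt) s ?l"
    using f real_of_coord_mono[of s ?l] real_of_coord_strict_mono[of s ?l] s
    by (auto simp del: real_of_coord.simps)
  have hi: "\<not> (if q1 \<or> q2 \<or> q3 then cle else clt) ?h s"
    using f real_of_coord_mono[of ?h s] real_of_coord_strict_mono[of ?h s] s
    by (auto simp del: real_of_coord.simps)
  have "cle ta (cadd a1 (cadd a2 a3)) \<or> cle tb (cadd b1 (cadd b2 b3)) \<or> cle tc (cadd c1 (cadd c2 c3))"
    using ok lo hi unfolding A B C g settled.simps by (auto split: if_splits)
  then show ?thesis
  proof (elim disjE)
    assume "cle ta (cadd a1 (cadd a2 a3))"
    from real_of_coord_mono[OF this] show ?thesis using f ta by (simp del: real_of_coord.simps)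
  next
    assume "cle tb (cadd b1 (cadd b2 b3))"
    from real_of_coord_mono[OF this] show ?thesis using f tb by (simp del: real_of_coord.simps)
  next
    assume "cle tc (cadd c1 (cadd c2 c3))"
    from real_of_coord_mono[OF this] show ?thesis using f tc by (simp del: real_of_coord.simps)
  qed
qed

definition triple_ok :: "(real \<Rightarrow> real) \<Rightarrow> int \<Rightarrow> triple \<Rightarrow> bool" where
  "triple_ok \<phi> m = (\<lambda>((i1, j1), (i2, j2), (i3, j3)). \<forall>i \<in> {i1..j1}. \<forall>j \<in> {i2..j2}. \<forall>k \<in> {i3..j3}.
     i \<le> j \<longrightarrow> j \<le> k \<longrightarrow> (\<forall>x \<in> face i. \<forall>y \<in> face j. \<forall>z \<in> face k. x + y + z = 4/5 + of_int m \<longrightarrow>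
       1 \<le> \<phi> x + \<phi> y + \<phi> z \<or> exempt ((i, i), (j, j), (k, k))))"

definition triple_in_table :: "triple \<Rightarrow> bool" where
  "triple_in_table = (\<lambda>((i1, j1), (i2, j2), (i3, j3)).
     1 \<le> i1 \<and> j1 \<le> 79 \<and> 1 \<le> i2 \<and> j2 \<le> 79 \<and> 1 \<le> i3 \<and> j3 \<le> 79)"

lemma halves_cover: "k \<in> {i..j} \<Longrightarrow> \<exists>(a, b) \<in> set (halves (i, j)). k \<in> {a..b}"
  by auto

lemma halves_bounds: "(a, b) \<in> set (halves (i, j)) \<Longrightarrow> i \<le> a \<and> b \<le> j"
  by (auto split: if_splits)

lemma triple_ok_halves:
  assumes "\<forall>t \<in> set (List.product (halves (i1, j1)) (List.product (halves (i2, j2)) (halves (i3, j3)))).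
    triple_ok \<phi> m t"
  shows "triple_ok \<phi> m ((i1, j1), (i2, j2), (i3, j3))"
proof -
  have "1 \<le> \<phi> x + \<phi> y + \<phi> z \<or> exempt ((i, i), (j, j), (k, k))"
    if h: "i \<in> {i1..j1}" "j \<in> {i2..j2}" "k \<in> {i3..j3}" "i \<le> j" "j \<le> k"
      "x \<in> face i" "y \<in> face j" "z \<in> face k" "x + y + z = 4/5 + of_int m" for i j k x y z
  proof -
    obtain a1 b1 where 1: "(a1, b1) \<in> set (halves (i1, j1))" "i \<in> {a1..b1}"
      using halves_cover[OF h(1)] by blast
    obtain a2 b2 where 2: "(a2, b2) \<in> set (halves (i2, j2))" "j \<in> {a2..b2}"
      using halves_cover[OF h(2)] by blast
    obtain a3 b3 where 3: "(a3, b3) \<in> set (halves (i3, j3))" "k \<in> {a3..b3}"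
      using halves_cover[OF h(3)] by blast
    have "triple_ok \<phi> m ((a1, b1), (a2, b2), (a3, b3))"
      using assms 1(1) 2(1) 3(1) by (simp del: halves.simps)
    then show ?thesis
      unfolding triple_ok_def prod.case using 1(2) 2(2) 3(2) h by blast
  qed
  then show ?thesis unfolding triple_ok_def by blast
qed

lemma triple_ok_settled:
  assumes "above_slack \<phi>" "triple_in_table ((i1, j1), (i2, j2), (i3, j3))"
    and "settled (thresholds m) (range_box i1 j1) (range_box i2 j2) (range_box i3 j3)"
  shows "triple_ok \<phi> m ((i1, j1), (i2, j2), (i3, j3))"
  using assms settled_correct[OF assms(3)] fits_range_box[OF assms(1)]
  unfolding triple_ok_def triple_in_table_def by auto

lemma triple_ok_exempt:
  "exempt ((i1, j1), (i2, j2), (i3, j3)) \<Longrightarrow> triple_ok \<phi> m ((i1, j1), (i2, j2), (i3, j3))"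
  by (auto simp: exempt_def triple_ok_def)

lemma refine_correct:
  assumes "above_slack \<phi>" "\<forall>t \<in> set ts. triple_in_table t"
  shows "(\<forall>t \<in> set (refine (thresholds m) ts). triple_in_table t) \<and>
     ((\<forall>t \<in> set (refine (thresholds m) ts). triple_ok \<phi> m t) \<longrightarrow> (\<forall>t \<in> set ts. triple_ok \<phi> m t))"
proof -
  have "(\<forall>t \<in> set (refine T ts). triple_in_table t) \<and>
     ((\<forall>t \<in> set (refine T ts). triple_ok \<phi> m t) \<longrightarrow> (\<forall>t \<in> set ts. triple_ok \<phi> m t))"
    if "T = thresholds m" for T
    using that assms(2)
  proof (induction T ts rule: refine.induct)
    case (2 T i1 j1 i2 j2 i3 j3 ws)
    let ?t = "((i1, j1), (i2, j2), (i3, j3))"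
    let ?new = "List.product (halves (i1, j1)) (List.product (halves (i2, j2)) (halves (i3, j3)))"
    have t: "triple_in_table ?t" and ws: "\<forall>t \<in> set ws. triple_in_table t" using 2(7) by simp_all
    show ?case
    proof (cases "j2 < i1 \<or> j3 < i2 \<or>
        settled T (range_box i1 j1) (range_box i2 j2) (range_box i3 j3) \<or> exempt ?t")
      case True
      have r: "refine T (?t # ws) = refine T ws" using True by auto
      have "triple_ok \<phi> m ?t"
        using True
      proof (elim disjE)
        assume "settled T (range_box i1 j1) (range_box i2 j2) (range_box i3 j3)"
        then show ?thesis using triple_ok_settled[OF assms(1) t, of m] 2(6) by simp
      next
        assume "exempt ?t"
        then show ?thesis by (rule triple_ok_exempt)
      qed (auto simp: triple_ok_def)
      moreover have "(\<forall>t \<in> set (refine T ws). triple_in_table t) \<and>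
          ((\<forall>t \<in> set (refine T ws). triple_ok \<phi> m t) \<longrightarrow> (\<forall>t \<in> set ws. triple_ok \<phi> m t))"
        using True 2(1-4,6) ws by blast
      ultimately show ?thesis unfolding r by simp
    next
      case False
      have r: "refine T (?t # ws) = ?new @ refine T ws" using False by simp
      have "\<forall>t \<in> set ?new. triple_in_table t"
        using t halves_bounds by (fastforce simp: triple_in_table_def simp del: halves.simps)
      moreover have "(\<forall>t \<in> set (refine T ws). triple_in_table t) \<and>
          ((\<forall>t \<in> set (refine T ws). triple_ok \<phi> m t) \<longrightarrow> (\<forall>t \<in> set ws. triple_ok \<phi> m t))"
        using False 2(5,6) ws by blast
      ultimately show ?thesis
        unfolding r using triple_ok_halves[of i1 j1 i2 j2 i3 j3 \<phi> m] by (auto simp del: halves.simps)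
    qed
  qed simp
  then show ?thesis by blast
qed

text \<open>If repeated refinement leaves no triple of ranges, then going backwards through the rounds settles the initial ones.\<close>

lemma refined_away_correct:
  assumes "above_slack \<phi>" "\<forall>t \<in> set ts. triple_in_table t" "(refine (thresholds m) ^^ n) ts = []"
  shows "\<forall>t \<in> set ts. triple_ok \<phi> m t"
  using assms(2,3)
proof (induction n arbitrary: ts)
  case (Suc n)
  then have "(refine (thresholds m) ^^ n) (refine (thresholds m) ts) = []"
    by (simp only: funpow_Suc_right o_apply)
  then show ?case using refine_correct[OF assms(1) Suc(2), of m] Suc.IH by blast
qed simp

section \<open>Perturbations on the special intervals\<close>

lemma breakpt_mono_le: "i < 41 \<Longrightarrow> j < 41 \<Longrightarrow> breakpt i \<le> breakpt j \<longleftrightarrow> i \<le> j"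
  using breakpt_mono[of j i] by linarith

lemma face_unique:
  assumes "x \<in> face j" "x \<in> face k" "1 \<le> j" "j \<le> 79" "1 \<le> k" "k \<le> 79"
  shows "j = k"
proof -
  have "\<not> j < k" if "x \<in> face j" "x \<in> face k" "1 \<le> j" "j \<le> 79" "1 \<le> k" "k \<le> 79" for j k
  proof
    assume "j < k"
    let ?a = "nat (j div 2)" and ?b = "nat (k div 2)"
    have ab: "?a < 40" "?b < 40" "if even k \<and> odd j then Suc ?a \<le> ?b else if odd j then Suc ?a \<le> ?b else if even k then ?a < ?b else ?a \<le> ?b"
      using that \<open>j < k\<close> by (auto elim!: evenE oddE simp: nat_le_eq_zle)
    have "x < x"
    proof (cases "odd j")
      case True
      then have "x < breakpt (Suc ?a)" "breakpt (Suc ?a) \<le> breakpt ?b" "breakpt ?b \<le> x"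
        using that(1,2) ab by (auto simp: face_def breakpt_mono_le split: if_splits)
      then show ?thesis by simp
    next
      case False
      then have "x = breakpt ?a" "breakpt ?a < x"
        using that(1,2) ab breakpt_mono[of ?a ?b] breakpt_mono_le[of ?a ?b] by (auto simp: face_def split: if_splits)
      then show ?thesis by simp
    qed
    then show False by simp
  qed
  from this[OF assms] this[OF assms(2,1) assms(5,6,3,4)] show ?thesis by linarith
qed

lemma special_faces: "face 35 = {219/800 <..< 269/800}" "face 39 = {371/800 <..< 421/800}"
  by (simp_all add: face_def breakpt_def pi_table_def eval_nat_numeral lim_at_def cont_at_def)

lemma pi_on_special: "y \<in> face 35 \<Longrightarrow> pi_fun y = 51443 / 147680 + 5 / 11999 * (y - 219/800)"
proof -
  assume "y \<in> face 35"
  then have "pi_fun y = chord (pi_table ! 17) (pi_table ! Suc 17) y"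
    by (intro pi_between) (simp_all add: face_def)
  also have "\<dots> = 51443 / 147680 + 5 / 11999 * (y - 219/800)"
    by (simp add: chord_def pi_table_def eval_nat_numeral lim_at_def cont_at_def)
  finally show ?thesis .
qed

text \<open>For these \<open>e\<close>, the reflection \<open>y \<mapsto> 4/5 - e - y\<close> maps \<open>(l, u)\<close> or a part of it to itself. The
second and the third exceed the first by \<open>t\<^sub>1 = 77/7752 sqrt 2\<close> and \<open>t\<^sub>2 = 77/2584\<close>.\<close>

definition swap_points :: "real set" where
  "swap_points = {19/100, 19/100 + 77/7752 * sqrt 2, 14199/64600}"

lemma swap_points_table: "swap_points = {breakpt 6, breakpt 10, breakpt 13}"
  by (simp add: swap_points_def breakpt_def pi_table_def eval_nat_numeral lim_at_def cont_at_def add.commute)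

text \<open>The three values \<open>\<pi>(e)\<close> lie on a line with slope \<open>5/11999\<close>, which is also the slope of \<open>\<pi>\<close> on \<open>(l, u)\<close>.\<close>

lemma swap_additive:
  assumes "e \<in> swap_points" "y \<in> face 35" "z \<in> face 35" "e + y + z = 4/5"
  shows "pi_fun e + pi_fun y + pi_fun z = 1"
proof -
  have e: "pi_fun (breakpt 6) = 18196/59995" "pi_fun (breakpt 10) = 385 / 93016248 * sqrt 2 + 18196 / 59995"
    "pi_fun (breakpt 13) = 50943 / 167960"
    by (simp_all add: pi_breakpoint, simp_all add: breakpt_value_def pi_table_def eval_nat_numeral lim_at_def cont_at_def)
  have breakpt: "breakpt 6 = 19/100" "breakpt 10 = 77/7752 * sqrt 2 + 19/100" "breakpt 13 = 14199/64600"
    by (simp_all add: breakpt_def pi_table_def eval_nat_numeral lim_at_def cont_at_def)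
  have pe: "pi_fun e = 18196/59995 + 5/11999 * (e - 19/100)"
    using assms(1) unfolding swap_points_table
    by (elim insertE emptyE; simp only: e; simp only: breakpt; simp add: field_simps)
  have "y + z = 4/5 - e" using assms(4) by simp
  then have "pi_fun y + pi_fun z = 51443 / 73840 + 5 / 11999 * (4/5 - e - 219/400)"
    unfolding pi_on_special[OF assms(2)] pi_on_special[OF assms(3)] by (simp add: algebra_simps)
  then show ?thesis
    using pe by (simp add: field_simps)
qed

text \<open>Minimality of \<open>\<pi> + p\<close> rests on these properties alone. They hold for 0 and for small multiples, of either sign, of
the microperiodic function.\<close>

locale perturbation =
  fixes p :: "real \<Rightarrow> real"
  assumes periodic: "p (x + of_int k) = p x"
    and small: "\<bar>p x\<bar> \<le> 3/10000"
    and support: "0 \<le> x \<Longrightarrow> x \<le> 1 \<Longrightarrow> x \<notin> face 35 \<Longrightarrow> x \<notin> face 39 \<Longrightarrow> p x = 0"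
    and odd: "p x + p (4/5 - x) = 0"
    and swap: "e \<in> swap_points \<Longrightarrow> y \<in> face 35 \<Longrightarrow> z \<in> face 35 \<Longrightarrow> e + y + z = 4/5 \<Longrightarrow> p y + p z = 0"
begin

definition perturbed :: "real \<Rightarrow> real" where "perturbed x = pi_fun x + p x"

lemma face_bounds: 
  assumes "1 \<le> k" "k \<le> 79" "x \<in> face k"
  shows "0 \<le> x \<and> x \<le> 1"
proof -
  let ?i = "nat (k div 2)"
  have "?i < 40" using assms by auto
  then have "0 \<le> breakpt ?i" "breakpt ?i \<le> 1" "breakpt (Suc ?i) \<le> 1"
    using breakpt_mono_le[of 0 ?i] breakpt_mono_le[of ?i 40] breakpt_mono_le[of "Suc ?i" 40] breakpt_ends by auto
  then show ?thesis using assms(3) by (auto simp: face_def split: if_splits)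
qed

lemma vanishes_off_special:
  assumes "1 \<le> k" "k \<le> 79" "k \<noteq> 35" "k \<noteq> 39" "x \<in> face k"
  shows "p x = 0"
proof -
  have "x \<notin> face 35" "x \<notin> face 39"
    using face_unique[of x k 35] face_unique[of x k 39] assms by auto
  then show ?thesis using support face_bounds assms by blast
qed

lemma above_slack_perturbed: "above_slack perturbed"
proof -
  have "pi_fun x - real_of_coord (slack k) \<le> perturbed x" if "1 \<le> k" "k \<le> 79" "x \<in> face k" for k x
  proof (cases "k = 35 \<or> k = 39")
    case True
    then show ?thesis using small[of x] by (auto simp: slack_def perturbed_def denom_def)
  next
    case False
    then show ?thesis using vanishes_off_special[OF that(1,2) _ _ that(3)] by (simp add: slack_def perturbed_def)
  qed
  then show ?thesis by (simp add: above_slack_def)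
qed

lemma three_terms_sorted:
  assumes "1 \<le> i" "i \<le> j" "j \<le> k" "k \<le> 79" and m: "m \<in> {0, 1, 2}"
    and mem: "x \<in> face i" "y \<in> face j" "z \<in> face k" and sum: "x + y + z = 4/5 + of_int m"
  shows "1 \<le> perturbed x + perturbed y + perturbed z"
proof -
  let ?t = "((1, 79), (1, 79), (1, 79)) :: triple"
  have "\<forall>t \<in> set [?t]. triple_in_table t" by (simp add: triple_in_table_def)
  from refined_away_correct[OF above_slack_perturbed this] m refined_away_0 refined_away_1 refined_away_2
  have "triple_ok perturbed m ?t" by auto
  then have "1 \<le> perturbed x + perturbed y + perturbed z \<or> exempt ((i, i), (j, j), (k, k))"
    unfolding triple_ok_def using assms by auto
  then show ?thesis
  proof
    assume "exempt ((i, i), (j, j), (k, k))"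
    then have ijk: "i \<in> {12, 20, 26}" "j = 35" "k = 35" by (auto simp: exempt_def)
    have x: "x \<in> swap_points" using mem(1) ijk(1) by (auto simp: face_def swap_points_table)
    have yz: "y \<in> face 35" "z \<in> face 35" using mem ijk by auto
    have "x < 1" using mem(1) ijk(1) breakpt_mono[of 6 40] breakpt_mono[of 10 40] breakpt_mono[of 13 40] breakpt_ends
      by (auto simp: face_def)
    with yz sum have "of_int m < (1 :: real)" by (auto simp: special_faces)
    then have "m = 0" using m by auto
    then have s: "x + y + z = 4/5" using sum by simp
    have "p x = 0" using vanishes_off_special[of i x] mem(1) ijk(1) by auto
    then show ?thesis using swap_additive[OF x yz s] swap[OF x yz s] by (simp add: perturbed_def)
  qed
qed

lemma three_terms:
  assumes xyz: "0 < x" "x < 1" "0 < y" "y < 1" "0 < z" "z < 1"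
    and m: "m \<in> {0, 1, 2}" and sum: "x + y + z = 4/5 + of_int m"
  shows "1 \<le> perturbed x + perturbed y + perturbed z"
proof -
  obtain i where i: "1 \<le> i" "i \<le> 79" "x \<in> face i" using face_exists xyz by blast
  obtain j where j: "1 \<le> j" "j \<le> 79" "y \<in> face j" using face_exists xyz by blast
  obtain k where k: "1 \<le> k" "k \<le> 79" "z \<in> face k" using face_exists xyz by blast
  note s = three_terms_sorted[OF _ _ _ _ m]
  consider "i \<le> j" "j \<le> k" | "i \<le> k" "k \<le> j" | "j \<le> i" "i \<le> k" | "j \<le> k" "k \<le> i"
    | "k \<le> i" "i \<le> j" | "k \<le> j" "j \<le> i" by linarith
  then show ?thesis
    using i j k sum
      s[of i j k x y z] s[of i k j x z y] s[of j i k y x z] s[of j k i y z x] s[of k i j z x y] s[of k j i z y x]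
    by cases (simp_all add: algebra_simps)
qed

lemma perturbed_periodic: "perturbed (x + of_int k) = perturbed x"
  by (simp add: perturbed_def pi_periodic periodic)

lemma perturbed_frac: "perturbed (frac x) = perturbed x"
  using perturbed_periodic[of "frac x" "\<lfloor>x\<rfloor>"] by (simp add: frac_def)

lemma perturbed_reflect: "perturbed x + perturbed (4/5 - x) = 1"
  using pi_reflect[of x] odd[of x] by (simp add: perturbed_def)

lemma perturbed_0: "perturbed 0 = 0"
proof -
  have "p 0 = 0" using support[of 0] by (simp add: special_faces)
  then show ?thesis using pi_breakpoint[of 0] breakpt_ends by (simp add: perturbed_def breakpt_value_def pi_table_def lim_at_def)
qed

text \<open>The bounds for the slope \<open>5/11999\<close> on the full range of faces are already nonnegative.\<close>

lemma perturbed_nonneg: "0 \<le> perturbed x"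
proof (cases "frac x = 0")
  case True
  then have "perturbed x = perturbed 0" using perturbed_frac[of x] by (simp only:)
  then show ?thesis using perturbed_0 by simp
next
  case False
  then have "0 < frac x" "frac x < 1" using frac_ge_0[of x] frac_lt_1[of x] by linarith+
  then obtain k where "1 \<le> k" "k \<le> 79" "frac x \<in> face k" using face_exists by blast
  then have f: "fits perturbed (range_box 1 79) (frac x)"
    by (intro fits_range_box[OF above_slack_perturbed]) auto
  obtain q r l h a b c where box: "range_box 1 79 = Box q r l h a b c" by (cases "range_box 1 79")
  have "cle (0, 0) b" using box by auto
  from real_of_coord_mono[OF this] have "0 \<le> 11999 * perturbed (frac x) - 5 * frac x"
    using f unfolding box by simp
  then show ?thesis using \<open>0 < frac x\<close> perturbed_frac[of x] by linarith
qed

text \<open>With \<open>z = 4/5 - (x + y)\<close> the claim is \<open>\<phi>(x) + \<phi>(y) + \<phi>(z) \<ge> 1\<close>. If one of the three is an integer, it follows from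
\<open>\<phi>(0) = 0\<close> and the symmetry; otherwise the fractional parts add up to \<open>4/5\<close>, \<open>9/5\<close> or \<open>14/5\<close>.\<close>

lemma perturbed_subadditive: "perturbed (x + y) \<le> perturbed x + perturbed y"
proof -
  define z where "z = 4/5 - (x + y)"
  have sum1: "perturbed (x + y) + perturbed z = 1" using perturbed_reflect[of "x + y"] by (simp add: z_def)
  consider "frac x = 0" | "frac y = 0" | "frac z = 0" | "frac x \<noteq> 0" "frac y \<noteq> 0" "frac z \<noteq> 0" by blast
  then show ?thesis
  proof cases
    case 1
    then have "x = of_int \<lfloor>x\<rfloor>" by (simp add: frac_def)
    then have "perturbed (x + y) = perturbed y" using perturbed_periodic[of y "\<lfloor>x\<rfloor>"] by (simp add: add.commute)
    then show ?thesis using perturbed_nonneg by simp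
  next
    case 2
    then have "y = of_int \<lfloor>y\<rfloor>" by (simp add: frac_def)
    then have "perturbed (x + y) = perturbed x" using perturbed_periodic[of x "\<lfloor>y\<rfloor>"] by simp
    then show ?thesis using perturbed_nonneg by simp
  next
    case 3
    then have "z = of_int \<lfloor>z\<rfloor>" by (simp add: frac_def)
    then have "y = 4/5 - x + of_int (- \<lfloor>z\<rfloor>)" by (simp add: z_def)
    then have "perturbed y = perturbed (4/5 - x)" using perturbed_periodic by metis
    then show ?thesis using perturbed_reflect[of x] perturbed_nonneg[of z] sum1 by simp
  next
    case 4
    then have pos: "0 < frac x" "frac x < 1" "0 < frac y" "frac y < 1" "0 < frac z" "frac z < 1"
      using frac_ge_0[of x] frac_ge_0[of y] frac_ge_0[of z] frac_lt_1[of x] frac_lt_1[of y] frac_lt_1[of z]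
      by linarith+
    define m where "m = - (\<lfloor>x\<rfloor> + \<lfloor>y\<rfloor> + \<lfloor>z\<rfloor>)"
    have s: "frac x + frac y + frac z = 4/5 + of_int m"
      by (simp add: frac_def m_def z_def)
    have "-1 < m" "m < 3" using s pos by linarith+
    then have "m \<in> {0, 1, 2}" by auto
    from three_terms[OF pos this s] show ?thesis using sum1 by (simp add: perturbed_frac)
  qed
qed

theorem minimal_valid_perturbed: "minimal_valid (4/5) (\<lambda>x. pi_fun x + p x)"
proof -
  have "perturbed x \<le> 1" for x using perturbed_reflect[of x] perturbed_nonneg[of "4/5 - x"] by linarith
  then have "minimal_valid (4/5) perturbed"
    using perturbed_nonneg perturbed_subadditive perturbed_0 perturbed_reflect perturbed_reflect[of 0]
      perturbed_periodic
    by (auto simp: minimal_valid_def Z_periodic_def)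
  then show ?thesis unfolding perturbed_def[abs_def] .
qed

end

section \<open>The dense group and the microperiodic function\<close>

lemma sqrt_2_irrational: "sqrt 2 \<notin> \<rat>"
proof
  assume "sqrt 2 \<in> \<rat>"
  then obtain m n :: nat where n: "n \<noteq> 0" and mn: "\<bar>sqrt 2\<bar> = real m / real n" and cop: "coprime m n"
    by (rule Rats_abs_nat_div_natE)
  have "real m = sqrt 2 * real n" using mn n by simp
  then have "(real m)\<^sup>2 = 2 * (real n)\<^sup>2" by (simp add: power_mult_distrib)
  then have eq: "m\<^sup>2 = 2 * n\<^sup>2" by (metis of_nat_eq_iff of_nat_mult of_nat_numeral of_nat_power)
  then have "even m" by (metis dvd_triv_left even_power pos2)
  then obtain k where "m = 2 * k" by blast
  with eq have "n\<^sup>2 = 2 * k\<^sup>2" by (simp add: power_mult_distrib)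
  then have "even n" by (metis dvd_triv_left even_power pos2)
  with \<open>even m\<close> cop show False by (metis coprime_common_divisor_nat dvd_def even_numeral odd_one)
qed

definition shift_group :: "real set" where
  "shift_group = {of_int a * (77/7752 * sqrt 2) + of_int b * (77/2584) | (a::int) (b::int). True}"

lemma shift_group_diff: "s \<in> shift_group \<Longrightarrow> t \<in> shift_group \<Longrightarrow> s - t \<in> shift_group"
proof -
  assume "s \<in> shift_group" "t \<in> shift_group"
  then obtain a b c d :: int where "s = of_int a * (77/7752 * sqrt 2) + of_int b * (77/2584)"
    "t = of_int c * (77/7752 * sqrt 2) + of_int d * (77/2584)" by (auto simp: shift_group_def)
  then have "s - t = of_int (a - c) * (77/7752 * sqrt 2) + of_int (b - d) * (77/2584)"
    by (simp only: of_int_diff left_diff_distrib)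
  then show ?thesis unfolding shift_group_def by blast
qed

lemma shift_group_0: "0 \<in> shift_group"
  by (auto simp: shift_group_def intro!: exI[of _ 0])

lemma shift_group_minus: "t \<in> shift_group \<Longrightarrow> - t \<in> shift_group"
  using shift_group_diff[OF shift_group_0] by force

lemma shift_group_minus_iff: "- t \<in> shift_group \<longleftrightarrow> t \<in> shift_group"
  using shift_group_minus[of t] shift_group_minus[of "- t"] by auto

lemma shift_group_add: "s \<in> shift_group \<Longrightarrow> t \<in> shift_group \<Longrightarrow> s + t \<in> shift_group"
  using shift_group_diff[of s "- t"] shift_group_minus by simp

lemma shift_group_generators: "77/7752 * sqrt 2 \<in> shift_group" "77/2584 \<in> shift_group"
  unfolding shift_group_def by (rule CollectI, rule exI[of _ 1], rule exI[of _ 0], simp)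
    (rule CollectI, rule exI[of _ 0], rule exI[of _ 1], simp)

lemma shift_group_add_iff: "s \<in> shift_group \<Longrightarrow> t + s \<in> shift_group \<longleftrightarrow> t \<in> shift_group"
  using shift_group_add[of t s] shift_group_diff[of "t + s" s] by auto

lemma shift_group_eq_group_closure: "shift_group = group_closure {77/7752 * sqrt 2, 77/2584}" (is "_ = group_closure ?S")
proof
  have mult: "of_int a * s \<in> group_closure ?S" if "s \<in> ?S" for a :: int and s
  proof -
    have "s \<in> group_closure ?S" using that by (intro group_closure.base) auto
    then have n: "of_nat n * s \<in> group_closure ?S" for n by (rule group_closure_scalar_mult_left)
    show ?thesis
      using n[of "nat a"] n[of "nat (- a)"] group_closure_minus_iff[of "of_int a * s" ?S]
      by (cases "0 \<le> a") auto
  qed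
  show "shift_group \<subseteq> group_closure ?S"
  proof
    fix t assume "t \<in> shift_group"
    then obtain a b :: int where "t = of_int a * (77/7752 * sqrt 2) + of_int b * (77/2584)"
      unfolding shift_group_def by blast
    then show "t \<in> group_closure ?S"
      using group_closure_add[OF mult[of "77/7752 * sqrt 2" a] mult[of "77/2584" b]] by (simp only: insert_iff simp_thms)
  qed
  show "group_closure ?S \<subseteq> shift_group"
  proof
    fix t assume "t \<in> group_closure ?S"
    then show "t \<in> shift_group"
    proof induction
      case (base s)
      then show ?case using shift_group_0 shift_group_generators by (elim insertE emptyE) (simp_all only:)
    next
      case (diff s t)
      then show ?case by (intro shift_group_diff)
    qed
  qed
qed

text \<open>The quotient of the generators is \<open>sqrt 2 / 3\<close>, so this is density of the fractional parts of its multiples.\<close>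

lemma shift_group_dense:
  assumes "\<epsilon> > 0"
  obtains t where "t \<in> shift_group" "\<bar>t - x\<bar> < \<epsilon>"
proof -
  have "sqrt 2 / 3 \<notin> \<rat>" using sqrt_2_irrational Rats_mult[of "sqrt 2 / 3" 3] by auto
  moreover have "\<epsilon> / (77/2584) > 0" using assms by simp
  ultimately obtain h k where "\<bar>of_int k * (sqrt 2 / 3) - of_int h - x / (77/2584)\<bar> < \<epsilon> / (77/2584)"
    using sequence_of_fractional_parts_is_dense by metis
  then have "\<bar>of_int k * (sqrt 2 / 3) - of_int h - x / (77/2584)\<bar> * (77/2584) < \<epsilon>"
    by (simp only: pos_less_divide_eq)
  moreover have "of_int k * (77/7752 * sqrt 2) + of_int (- h) * (77/2584) - x =
    (of_int k * (sqrt 2 / 3) - of_int h - x / (77/2584)) * (77/2584)"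
    by (simp add: field_simps)
  ultimately have "\<bar>of_int k * (77/7752 * sqrt 2) + of_int (- h) * (77/2584) - x\<bar> < \<epsilon>"
    by (simp only: abs_mult)
  moreover have "of_int k * (77/7752 * sqrt 2) + of_int (- h) * (77/2584) \<in> shift_group" unfolding shift_group_def by blast
  ultimately show thesis by (rule that[rotated])
qed

lemma closure_shift_group: "closure shift_group = UNIV"
  using shift_group_dense by (auto simp: closure_approachable dist_real_def) metis

text \<open>The number \<open>1/16 = u - l\<close> is the length of a special interval. That it is not in the group keeps apart the
cosets of the two endpoints, on which the microperiodic function takes opposite values.\<close>

lemma length_notin_shift_group: "1/16 \<notin> shift_group"
proof
  assume "1/16 \<in> shift_group"
  then obtain a b :: int where ab: "1/16 = of_int a * (77/7752 * sqrt 2) + of_int b * (77/2584)"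
    by (auto simp: shift_group_def)
  then have eq: "of_int (154 * a) * sqrt 2 = of_int (969 - 462 * b)"
    by (simp add: field_simps)
  show False
  proof (cases "a = 0")
    case True
    then have "(of_int (462 * b) :: real) = of_int 969" using eq by simp
    then have "462 * b = 969" by (simp only: of_int_eq_iff)
    then show False by presburger
  next
    case False
    then have "sqrt 2 = of_int (969 - 462 * b) / of_int (154 * a)" using eq by (simp add: field_simps)
    then have "sqrt 2 \<in> \<rat>" by (metis Rats_divide Rats_of_int)
    then show False using sqrt_2_irrational by simp
  qed
qed

text \<open>The common profile of the microperiodic function on both special intervals, as a function of the distance from the left
end.\<close>

definition sign_at :: "real \<Rightarrow> real" where
  "sign_at d = (if d \<in> shift_group then 1 else if d - 1/16 \<in> shift_group then -1 else 0)"

lemma sign_at_mirror: "sign_at (1/16 - d) = - sign_at d"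
proof -
  have 1: "1/16 - d - 1/16 \<in> shift_group \<longleftrightarrow> d \<in> shift_group" using shift_group_minus_iff[of d] by simp
  have 2: "1/16 - d \<in> shift_group \<longleftrightarrow> d - 1/16 \<in> shift_group" using shift_group_minus_iff[of "d - 1/16"] by simp
  have "d \<notin> shift_group \<or> d - 1/16 \<notin> shift_group" using shift_group_diff[of d "d - 1/16"] length_notin_shift_group by auto
  then show ?thesis using 1 2 by (auto simp: sign_at_def)
qed

lemma sign_at_translate: "t \<in> shift_group \<Longrightarrow> sign_at (d - t) = sign_at d"
  using shift_group_add_iff[of "- t" d] shift_group_add_iff[of "- t" "d - 1/16"] shift_group_minus
  by (simp add: sign_at_def algebra_simps)

locale microperiodic_bar =
  fixes pi_bar :: "real \<Rightarrow> real"
  assumes periodic: "Z_periodic pi_bar"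
    and on_unit_interval: "\<forall>x \<in> {0..<1}. pi_bar x =
      (if x \<in> {219/800<..<269/800} \<and> x - 219/800 \<in> shift_group \<or> x \<in> {4/5 - 269/800<..<4/5 - 219/800} \<and> x - 4/5 + 269/800 \<in> shift_group then 1
       else if x \<in> {219/800<..<269/800} \<and> x - 269/800 \<in> shift_group \<or> x \<in> {4/5 - 269/800<..<4/5 - 219/800} \<and> x - 4/5 + 219/800 \<in> shift_group then -1
       else 0)"
begin

lemma bar_values:
  "x \<in> face 35 \<Longrightarrow> pi_bar x = sign_at (x - 219/800)"
  "x \<in> face 39 \<Longrightarrow> pi_bar x = sign_at (x - 371/800)"
  "0 \<le> x \<Longrightarrow> x < 1 \<Longrightarrow> x \<notin> face 35 \<Longrightarrow> x \<notin> face 39 \<Longrightarrow> pi_bar x = 0"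
proof -
  have "{4/5 - 269/800<..<4/5 - 219/800} = {371/800<..<421/800 :: real}" by simp
  note v = on_unit_interval[unfolded this, folded special_faces]
  show "x \<in> face 35 \<Longrightarrow> pi_bar x = sign_at (x - 219/800)"
    "x \<in> face 39 \<Longrightarrow> pi_bar x = sign_at (x - 371/800)"
    using on_unit_interval by (simp_all add: special_faces sign_at_def)
  show "0 \<le> x \<Longrightarrow> x < 1 \<Longrightarrow> x \<notin> face 35 \<Longrightarrow> x \<notin> face 39 \<Longrightarrow> pi_bar x = 0"
    using v by simp
qed

lemma bar_periodic: "pi_bar (x + of_int k) = pi_bar x"
  using periodic by (simp add: Z_periodic_def)

lemma bar_frac: "pi_bar x = pi_bar (frac x)"
  using bar_periodic[of "frac x" "\<lfloor>x\<rfloor>"] by (simp add: frac_def)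

lemma bar_bounded: "\<bar>pi_bar x\<bar> \<le> 1"
proof -
  have "\<bar>pi_bar (frac x)\<bar> \<le> 1"
    using bar_values(1,2,3)[of "frac x"] frac_lt_1[of x] frac_ge_0[of x]
    by (cases "frac x \<in> face 35"; cases "frac x \<in> face 39") (auto simp: sign_at_def)
  then show ?thesis using bar_frac by simp
qed

lemma bar_odd: "pi_bar x + pi_bar (4/5 - x) = 0"
proof -
  define y where "y = frac x"
  have y: "0 \<le> y" "y < 1" by (simp_all add: y_def frac_lt_1)
  have x: "x = y + of_int \<lfloor>x\<rfloor>" by (simp add: y_def frac_def)
  have "pi_bar y + pi_bar (4/5 - y) = 0"
  proof -
    consider "y \<in> face 35" | "y \<in> face 39" | "y \<notin> face 35" "y \<notin> face 39" "y \<le> 4/5"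
      | "y \<notin> face 35" "y \<notin> face 39" "4/5 < y" by linarith
    then show ?thesis
    proof cases
      case 1
      then have "4/5 - y \<in> face 39" by (simp add: special_faces)
      then show ?thesis using 1 sign_at_mirror[of "y - 219/800"] by (simp add: bar_values algebra_simps)
    next
      case 2
      then have "4/5 - y \<in> face 35" by (simp add: special_faces)
      then show ?thesis using 2 sign_at_mirror[of "y - 371/800"] by (simp add: bar_values algebra_simps)
    next
      case 3
      then have "4/5 - y \<notin> face 35" "4/5 - y \<notin> face 39" by (auto simp: special_faces)
      then show ?thesis using 3 y by (simp add: bar_values)
    next
      case 4
      then have "9/5 - y \<notin> face 35" "9/5 - y \<notin> face 39" using y by (auto simp: special_faces)
      then have "pi_bar (9/5 - y) = 0" using 4 y by (simp add: bar_values)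
      then show ?thesis using 4 y bar_periodic[of "4/5 - y" 1] by (simp add: bar_values algebra_simps)
    qed
  qed
  then show ?thesis
    using bar_periodic[of y "\<lfloor>x\<rfloor>"] bar_periodic[of "4/5 - y" "- \<lfloor>x\<rfloor>"] x by (simp add: algebra_simps)
qed

lemma bar_swap:
  assumes e: "e \<in> swap_points" and yz: "y \<in> face 35" "z \<in> face 35" and sum: "e + y + z = 4/5"
  shows "pi_bar y + pi_bar z = 0"
proof -
  have "e - 19/100 \<in> shift_group" using e unfolding swap_points_def
    by (elim insertE emptyE; hypsubst; use shift_group_0 shift_group_generators in simp)
  then have "sign_at (1/16 - (y - 219/800) - (e - 19/100)) = - sign_at (y - 219/800)"
    by (simp only: sign_at_translate sign_at_mirror)
  moreover have "z - 219/800 = 1/16 - (y - 219/800) - (e - 19/100)" using sum by simp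
  ultimately show ?thesis using yz by (simp only: bar_values)
qed

lemma perturbation_bar:
  assumes "\<bar>c\<bar> \<le> 3/10000"
  shows "perturbation (\<lambda>x. c * pi_bar x)"
proof
  fix x y z e :: real and k :: int
  show "c * pi_bar (x + of_int k) = c * pi_bar x" by (simp add: bar_periodic)
  show "\<bar>c * pi_bar x\<bar> \<le> 3/10000"
    using mult_mono[OF assms bar_bounded[of x]] by (simp add: abs_mult)
  show "c * pi_bar x = 0" if "0 \<le> x" "x \<le> 1" "x \<notin> face 35" "x \<notin> face 39"
  proof (cases "x = 1")
    case True
    then show ?thesis using bar_periodic[of 0 1] bar_values(3)[of 0] by (simp add: special_faces)
  next
    case False
    then show ?thesis using that by (simp add: bar_values)
  qed
  show "c * pi_bar x + c * pi_bar (4/5 - x) = 0"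
    using bar_odd[of x] by (simp add: distrib_left[symmetric])
  show "c * pi_bar y + c * pi_bar z = 0"
    if "e \<in> swap_points" "y \<in> face 35" "z \<in> face 35" "e + y + z = 4/5"
    using bar_swap[OF that] by (simp add: distrib_left[symmetric])
qed

lemma bar_nonzero: "pi_bar (219/800 + 77/2584) = 1"
proof -
  have "219/800 + 77/2584 \<in> face 35" by (simp add: special_faces)
  then show ?thesis using bar_values(1) shift_group_generators by (simp add: sign_at_def)
qed

definition bar_breakpoints :: "real set" where
  "bar_breakpoints = {z. frac z \<in> {0, 219/800, 269/800, 371/800, 421/800}}"

lemma breakpoint_set_bar: "breakpoint_set bar_breakpoints"
proof -
  let ?y = "\<lambda>i. [0, 219/800, 269/800, 371/800, 421/800, 1] ! i :: real"
  have "bar_breakpoints = {?y i + of_int t | i (t::int). i < 5}"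
  proof (intro set_eqI iffI)
    fix z assume "z \<in> bar_breakpoints"
    then obtain i where "i < 5" "frac z = ?y i"
      by (auto simp: bar_breakpoints_def intro: that[of 0] that[of 1] that[of 2] that[of 3] that[of 4])
    then have "z = ?y i + of_int \<lfloor>z\<rfloor>" by (simp add: frac_def algebra_simps)
    then show "z \<in> {?y i + of_int t | i (t::int). i < 5}" using \<open>i < 5\<close> by blast
  next
    fix z assume "z \<in> {?y i + of_int t | i (t::int). i < 5}"
    then obtain i t where z: "z = ?y i + of_int t" "i < 5" by blast
    then have i: "i \<in> {0, 1, 2, 3, 4}" by auto
    then have "frac z = ?y i" using z by (intro frac_unique_iff[THEN iffD2]) auto
    then show "z \<in> bar_breakpoints" using i by (auto simp: bar_breakpoints_def)
  qed
  moreover have "\<forall>i<5. ?y i < ?y (Suc i)"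
    by (auto simp: less_Suc_eq numeral_eq_Suc)
  ultimately show ?thesis unfolding breakpoint_set_def by (intro exI[of _ 5] exI[of _ ?y]) simp
qed

lemma bar_breakpoints_special:
  "219/800 \<in> bar_breakpoints" "269/800 \<in> bar_breakpoints" "371/800 \<in> bar_breakpoints" "421/800 \<in> bar_breakpoints"
  "{219/800<..<269/800} \<inter> bar_breakpoints = {}" "{371/800<..<421/800} \<inter> bar_breakpoints = {}"
  by (auto simp: bar_breakpoints_def frac_eq[THEN iffD2] simp del: frac_eq_0_iff)

lemma bar_vanishes_at_breakpoints: "x \<in> bar_breakpoints \<Longrightarrow> pi_bar x = 0"
  unfolding bar_frac[of x] bar_breakpoints_def by (auto simp: bar_values special_faces simp del: frac_eq_0_iff)

lemma surrounding_interval: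
  assumes "s \<in> B" "t \<in> B" "{s<..<t} \<inter> B = {}" "a \<in> B" "b \<in> B" "{a<..<b} \<inter> B = {}"
    and "x \<in> {a<..<b}" "x \<in> {s<..<t}"
  shows "a = s \<and> b = (t :: real)"
proof -
  have "\<not> (a < s \<and> s < b)" "\<not> (a < t \<and> t < b)" "\<not> (s < a \<and> a < t)" "\<not> (s < b \<and> b < t)"
    using assms(1-6) by (metis disjoint_iff greaterThanLessThan_iff)+
  then show ?thesis using assms(7,8) by auto
qed

definition left_end :: "real set \<Rightarrow> real" where
  "left_end I = (if I = {219/800..269/800} then 219/800 else 371/800)"

definition cosets :: "real set \<Rightarrow> real set set" where
  "cosets I = (if I = {219/800..269/800} \<or> I = {371/800..421/800}
     then {(+) (left_end I) ` shift_group, (+) (left_end I + 1/16) ` shift_group} else {})"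

lemma coset_mem: "x \<in> (+) b ` shift_group \<longleftrightarrow> x - b \<in> shift_group"
  by (auto simp: image_iff algebra_simps) (metis add.commute diff_add_cancel)

lemma locally_microperiodic_bar: "locally_microperiodic pi_bar"
proof -
  let ?c = "\<lambda>I A. if A = (+) (left_end I) ` shift_group then 1 else (-1 :: real)"
  have special: "finite (cosets I) \<and> (\<forall>A \<in> cosets I. \<exists>b. A = (+) b ` shift_group) \<and>
      (\<forall>A \<in> cosets I. ?c I A \<noteq> 0 \<and> (\<forall>x \<in> A \<inter> interior I. pi_bar x = ?c I A)) \<and>
      (\<forall>x \<in> interior I - \<Union>(cosets I). pi_bar x = 0)"
    if I: "I = {219/800..269/800} \<or> I = {371/800..421/800}" for I
  proof -
    let ?s = "left_end I"
    have int: "pi_bar x = sign_at (x - ?s)" if "x \<in> interior I" for x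
      using I that bar_values(1,2)[of x] by (auto simp: left_end_def special_faces interior_atLeastAtMost_real)
    have ne: "(+) (?s + 1/16) ` shift_group \<noteq> (+) ?s ` shift_group"
    proof
      assume "(+) (?s + 1/16) ` shift_group = (+) ?s ` shift_group"
      moreover have "?s + 1/16 \<in> (+) (?s + 1/16) ` shift_group" using shift_group_0 by (simp add: coset_mem)
      ultimately show False using length_notin_shift_group by (simp add: coset_mem)
    qed
    have c: "cosets I = {(+) ?s ` shift_group, (+) (?s + 1/16) ` shift_group}" using I by (simp add: cosets_def)
    have v1: "pi_bar x = 1" if "x \<in> interior I" "x \<in> (+) ?s ` shift_group" for x
      using that int by (simp add: coset_mem sign_at_def)
    have v2: "pi_bar x = -1" if "x \<in> interior I" "x \<in> (+) (?s + 1/16) ` shift_group" for x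
      using that int shift_group_diff[of "x - ?s" "x - ?s - 1/16"] length_notin_shift_group
      by (auto simp: coset_mem sign_at_def algebra_simps)
    have v0: "pi_bar x = 0" if "x \<in> interior I" "x \<notin> (+) ?s ` shift_group" "x \<notin> (+) (?s + 1/16) ` shift_group" for x
      using that int[of x] unfolding coset_mem sign_at_def by (simp add: diff_diff_eq)
    show ?thesis unfolding c using ne v0 v1 v2 by auto
  qed
  have other: "finite (cosets I) \<and> (\<forall>A \<in> cosets I. \<exists>b. A = (+) b ` shift_group) \<and>
      (\<forall>A \<in> cosets I. ?c I A \<noteq> 0 \<and> (\<forall>x \<in> A \<inter> interior I. pi_bar x = ?c I A)) \<and>
      (\<forall>x \<in> interior I - \<Union>(cosets I). pi_bar x = 0)"
    if face: "I \<in> interval_faces bar_breakpoints" "I \<subseteq> {0..1}"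
      and not: "\<not> (I = {219/800..269/800} \<or> I = {371/800..421/800})" for I
  proof -
    obtain a b where ab: "I = {a..b}" "a \<in> bar_breakpoints" "b \<in> bar_breakpoints" "a < b"
      "{a<..<b} \<inter> bar_breakpoints = {}" using face(1) by (auto simp: interval_faces_def)
    have "pi_bar x = 0" if "x \<in> interior I" for x
    proof -
      have x: "x \<in> {a<..<b}" using that ab(1) by (simp add: interior_atLeastAtMost_real)
      have "x \<notin> face 35" "x \<notin> face 39"
        using surrounding_interval[OF bar_breakpoints_special(1,2,5) ab(2,3,5) x]
          surrounding_interval[OF bar_breakpoints_special(3,4,6) ab(2,3,5) x] not ab(1)
        by (auto simp: special_faces)
      moreover have "0 \<le> a" "b \<le> 1" using face(2) ab(1,4) by auto
      then have "0 \<le> x" "x < 1" using x by auto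
      ultimately show ?thesis by (intro bar_values(3))
    qed
    then show ?thesis using not by (simp add: cosets_def)
  qed
  have special_face: "{219/800..269/800} \<in> interval_faces bar_breakpoints"
    unfolding interval_faces_def using bar_breakpoints_special(1,2,5)
    by (intro CollectI exI[of _ "219/800"] exI[of _ "269/800"]) auto
  show ?thesis
    unfolding locally_microperiodic_def
  proof (intro conjI exI)
    show "finite {77/7752 * sqrt 2, 77/2584 :: real}" by simp
    show "\<forall>I\<in>interval_faces bar_breakpoints. I \<subseteq> {0..1} \<longrightarrow>
        finite (cosets I) \<and> (\<forall>A \<in> cosets I. \<exists>b. A = (+) b ` shift_group) \<and>
        (\<forall>A \<in> cosets I. ?c I A \<noteq> 0 \<and> (\<forall>x \<in> A \<inter> interior I. pi_bar x = ?c I A)) \<and>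
        (\<forall>x \<in> interior I - \<Union>(cosets I). pi_bar x = 0)"
    proof (intro ballI impI)
      fix I assume "I \<in> interval_faces bar_breakpoints" "I \<subseteq> {0..1}"
      then show "finite (cosets I) \<and> (\<forall>A \<in> cosets I. \<exists>b. A = (+) b ` shift_group) \<and>
          (\<forall>A \<in> cosets I. ?c I A \<noteq> 0 \<and> (\<forall>x \<in> A \<inter> interior I. pi_bar x = ?c I A)) \<and>
          (\<forall>x \<in> interior I - \<Union>(cosets I). pi_bar x = 0)"
        by (cases "I = {219/800..269/800} \<or> I = {371/800..421/800}") (rule special, assumption, rule other)
    qed
    show "\<exists>I \<in> interval_faces bar_breakpoints. I \<subseteq> {0..1} \<and> cosets I \<noteq> {}"
      using special_face by (intro bexI[of _ "{219/800..269/800}"]) (auto simp: cosets_def)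
    show "\<forall>x \<in> bar_breakpoints. pi_bar x = 0" using bar_vanishes_at_breakpoints by blast
  qed (fact periodic shift_group_eq_group_closure closure_shift_group breakpoint_set_bar)+
qed

end

section \<open>Additive functions, dense translations and piecewise continuity\<close>

text \<open>An additive function with a zero at \<open>c\<close> is periodic with period \<open>c\<close>, so doubling followed by reduction modulo \<open>c\<close> stays
in \<open>[0, c)\<close>. It doubles the value each time, which a bounded function cannot afford.\<close>

lemma locally_additive_vanishes:
  fixes r :: "real \<Rightarrow> real"
  assumes bounded: "\<And>d. 0 \<le> d \<Longrightarrow> d < L \<Longrightarrow> \<bar>r d\<bar> \<le> M"
    and add: "\<And>d e. 0 \<le> d \<Longrightarrow> 0 \<le> e \<Longrightarrow> d + e < L \<Longrightarrow> r (d + e) = r d + r e"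
    and period: "r c = 0" "0 < c" "2 * c < L"
    and d: "0 \<le> d" "d < c"
  shows "r d = 0"
proof -
  have double: "\<exists>d'. 0 \<le> d' \<and> d' < c \<and> r d' = 2 * r d" if "0 \<le> d" "d < c" for d
  proof (cases "2 * d < c")
    case True
    then show ?thesis using that add[of d d] period by (intro exI[of _ "2 * d"]) auto
  next
    case False
    have "r (2 * d) = 2 * r d" using add[of d d] that period by auto
    moreover have "r (2 * d) = r (2 * d - c) + r c" using add[of "2 * d - c" c] that False period by auto
    ultimately show ?thesis using that False period by (intro exI[of _ "2 * d - c"]) auto
  qed
  have "\<exists>d'. 0 \<le> d' \<and> d' < c \<and> r d' = 2 ^ n * r d" for n
  proof (induction n)
    case 0
    then show ?case using d by auto
  next
    case (Suc n)
    then obtain d' where "0 \<le> d'" "d' < c" "r d' = 2 ^ n * r d" by blast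
    then show ?case using double[of d'] by auto
  qed
  then have bound: "2 ^ n * \<bar>r d\<bar> \<le> M" for n
    using bounded period by (metis abs_mult abs_numeral power_abs less_trans mult_2 less_add_same_cancel1)
  show ?thesis
  proof (rule ccontr)
    assume "r d \<noteq> 0"
    then obtain n where "M / \<bar>r d\<bar> < 2 ^ n" using real_arch_pow[of 2 "M / \<bar>r d\<bar>"] by auto
    then show False using bound[of n] \<open>r d \<noteq> 0\<close> by (simp add: field_simps)
  qed
qed

text \<open>Additivity is known only for pairs whose sum is still in the interval. On the lower half \<open>(a, b/2)\<close> it makes the increments
independent of the position, hence additive, hence linear. This gives \<open>q x = s x + k\<close> on \<open>(a, b/2)\<close>
and, by doubling, \<open>q x = s x + 2 k\<close> on \<open>(2 a, b)\<close>. The hypothesis \<open>4 a < b\<close> makes these two intervals overlap.\<close>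

lemma bounded_additive_on_interval_linear:
  fixes q :: "real \<Rightarrow> real"
  assumes ab: "0 < a" "4 * a < b"
    and bounded: "\<And>x. \<bar>q x\<bar> \<le> M"
    and add: "\<And>x y. a < x \<Longrightarrow> a < y \<Longrightarrow> x + y < b \<Longrightarrow> q (x + y) = q x + q y"
  obtains s where "\<And>x. a < x \<Longrightarrow> x < b \<Longrightarrow> q x = s * x"
proof -
  define L where "L = b / 2 - a"
  have L: "0 < L" using ab by (simp add: L_def)
  have shift: "q (x + d) - q x = q (y + d) - q y"
    if "a < x" "a < y" "0 \<le> d" "x + d < b / 2" "y + d < b / 2" for x y d
    using add[of "x + d" y] add[of x "y + d"] that by (simp add: algebra_simps)
  define r0 where "r0 d = q ((a + b / 2 - d) / 2 + d) - q ((a + b / 2 - d) / 2)" for d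
  have r0: "q (x + d) - q x = r0 d" if "a < x" "0 \<le> d" "x + d < b / 2" for x d
    unfolding r0_def using that by (intro shift) (auto simp: field_simps)
  have r0_add: "r0 (d + e) = r0 d + r0 e" if "0 \<le> d" "0 \<le> e" "d + e < L" for d e
  proof -
    define x where "x = (a + b / 2 - (d + e)) / 2"
    have x: "a < x" "x + (d + e) < b / 2" using that by (auto simp: x_def L_def field_simps)
    then show ?thesis using r0[of x "d + e"] r0[of x d] r0[of "x + d" e] that by (simp add: algebra_simps)
  qed
  \<comment> \<open>Any \<open>c\<close> between \<open>L / 4\<close> and \<open>L / 2\<close> would do; the slope is chosen so that \<open>r0 d - s d\<close> vanishes at \<open>c\<close>.\<close>
  define c where "c = L / 3"
  define s where "s = r0 c / c"
  have c: "0 < c" "2 * c < L" using L by (auto simp: c_def)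
  have r0_linear_small: "r0 d = s * d" if "0 \<le> d" "d < c" for d
  proof -
    have "r0 d - s * d = 0"
    proof (rule locally_additive_vanishes[where r = "\<lambda>d. r0 d - s * d" and M = "2 * M + \<bar>s\<bar> * L" and L = L and c = c])
      fix d assume d: "0 \<le> d" "d < L"
      have "\<bar>r0 d\<bar> \<le> 2 * M" unfolding r0_def using bounded by (smt (verit))
      moreover have "\<bar>s * d\<bar> \<le> \<bar>s\<bar> * L" unfolding abs_mult using d by (intro mult_left_mono) auto
      ultimately show "\<bar>r0 d - s * d\<bar> \<le> 2 * M + \<bar>s\<bar> * L" by linarith
    next
      fix d e :: real assume "0 \<le> d" "0 \<le> e" "d + e < L"
      then show "r0 (d + e) - s * (d + e) = r0 d - s * d + (r0 e - s * e)"
        using r0_add by (simp add: algebra_simps)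
    qed (use c that in \<open>auto simp: s_def\<close>)
    then show ?thesis by simp
  qed
  have r0_linear: "r0 d = s * d" if "0 \<le> d" "d < L" for d
  proof -
    have "r0 (d / 4) = s * (d / 4)" using that c by (intro r0_linear_small) (auto simp: c_def)
    moreover have "r0 (d / 2) = 2 * r0 (d / 4)" "r0 d = 2 * r0 (d / 2)"
      using r0_add[of "d / 4" "d / 4"] r0_add[of "d / 2" "d / 2"] that by auto
    ultimately show ?thesis by simp
  qed
  define x0 where "x0 = (a + b / 4) / 2"
  define k where "k = q x0 - s * x0"
  have lower: "q x = s * x + k" if "a < x" "x < b / 2" for x
  proof -
    have x0: "a < x0" "x0 < b / 2" using ab by (auto simp: x0_def)
    show ?thesis
    proof (cases "x0 \<le> x")
      case True
      then have "q x - q x0 = s * (x - x0)"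
        using r0[of x0 "x - x0"] r0_linear[of "x - x0"] that x0 by (auto simp: L_def)
      then show ?thesis by (simp add: k_def algebra_simps)
    next
      case False
      then have "q x0 - q x = s * (x0 - x)"
        using r0[of x "x0 - x"] r0_linear[of "x0 - x"] that x0 by (auto simp: L_def)
      then show ?thesis by (simp add: k_def algebra_simps)
    qed
  qed
  have upper: "q x = s * x + 2 * k" if "2 * a < x" "x < b" for x
    using add[of "x / 2" "x / 2"] lower[of "x / 2"] that ab by auto
  have "k = 0"
    using lower[of "(2 * a + b / 2) / 2"] upper[of "(2 * a + b / 2) / 2"] ab by auto
  then have "q x = s * x" if "a < x" "x < b" for x
    using lower[of x] upper[of x] that ab by (cases "x < b / 2") auto
  then show thesis by (rule that)
qed

text \<open>Steps may be taken only inside \<open>(l, u)\<close>. If two step directions are still to be used with opposite signs, at least one of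
them does not leave the interval, because \<open>s + t < u - l\<close>; with equal signs no step overshoots the target.\<close>

lemma invariant_under_steps:
  fixes g :: "real \<Rightarrow> real"
  assumes pos: "0 < s" "0 < t" "s + t < u - l"
    and inv_s: "\<And>y. l < y \<Longrightarrow> y + s < u \<Longrightarrow> g (y + s) = g y"
    and inv_t: "\<And>y. l < y \<Longrightarrow> y + t < u \<Longrightarrow> g (y + t) = g y"
    and xy: "l < x" "x < u" "l < x + of_int i * s + of_int j * t" "x + of_int i * s + of_int j * t < u"
  shows "g (x + of_int i * s + of_int j * t) = g x"
  using xy
proof (induction "nat \<bar>i\<bar> + nat \<bar>j\<bar>" arbitrary: x i j rule: less_induct)
  case less
  let ?y = "x + of_int i * s + of_int j * t"
  have s_step: "s \<le> of_int i * s" if "0 < i"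
    using that pos mult_right_mono[of 1 "of_int i" s] by simp
  have s_step': "of_int i * s \<le> - s" if "i < 0"
    using that pos mult_right_mono[of "of_int i" "-1" s] by simp
  have t_step: "t \<le> of_int j * t" if "0 < j"
    using that pos mult_right_mono[of 1 "of_int j" t] by simp
  have t_step': "of_int j * t \<le> - t" if "j < 0"
    using that pos mult_right_mono[of "of_int j" "-1" t] by simp
  have i: "i = 0 \<and> of_int i * s = 0 \<or> 0 < i \<and> s \<le> of_int i * s \<or> i < 0 \<and> of_int i * s \<le> - s"
    using s_step s_step' by fastforce
  have j: "j = 0 \<and> of_int j * t = 0 \<or> 0 < j \<and> t \<le> of_int j * t \<or> j < 0 \<and> of_int j * t \<le> - t"
    using t_step t_step' by fastforce
  have "i = 0 \<and> j = 0 \<or> 0 < i \<and> x + s < u \<or> i < 0 \<and> l < x - s \<or> 0 < j \<and> x + t < u \<or> j < 0 \<and> l < x - t"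
    using i j less.prems pos by (smt (verit))
  then consider "i = 0" "j = 0" | "0 < i" "x + s < u" | "i < 0" "l < x - s" | "0 < j" "x + t < u" | "j < 0" "l < x - t"
    by blast
  then show ?case
  proof cases
    case 2
    have "g (x + s + of_int (i - 1) * s + of_int j * t) = g (x + s)"
      using 2 less.prems pos by (intro less.hyps) (auto simp: algebra_simps)
    then show ?thesis using inv_s[of x] 2 less.prems by (simp add: algebra_simps)
  next
    case 3
    have "g (x - s + of_int (i + 1) * s + of_int j * t) = g (x - s)"
      using 3 less.prems pos by (intro less.hyps) (auto simp: algebra_simps)
    then show ?thesis using inv_s[of "x - s"] 3 less.prems by (simp add: algebra_simps)
  next
    case 4
    have "g (x + t + of_int i * s + of_int (j - 1) * t) = g (x + t)"
      using 4 less.prems pos by (intro less.hyps) (auto simp: algebra_simps)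
    then show ?thesis using inv_t[of x] 4 less.prems by (simp add: algebra_simps)
  next
    case 5
    have "g (x - t + of_int i * s + of_int (j + 1) * t) = g (x - t)"
      using 5 less.prems pos by (intro less.hyps) (auto simp: algebra_simps)
    then show ?thesis using inv_t[of "x - t"] 5 less.prems by (simp add: algebra_simps)
  qed simp
qed

lemma piecewise_continuous_right:
  assumes "piecewise_continuous g" "0 \<le> l" "l < 1"
  obtains d where "l < d" "continuous_on {l<..<d} g"
proof -
  obtain B where B: "breakpoint_set B" "\<forall>F \<in> polyhedral_complex B. continuous_on (rel_interior F) g"
    using assms(1) by (auto simp: piecewise_continuous_def)
  obtain n and y :: "nat \<Rightarrow> real" where y: "y 0 = 0" "y n = 1" "\<forall>i<n. y i < y (Suc i)"
    "B = {y i + of_int t | i (t::int). i < n}" using B(1) unfolding breakpoint_set_def by blast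
  have mono: "y i < y j" if "i < j" "j \<le> n" for i j
    using that
  proof (induction j)
    case (Suc j)
    then show ?case using y(3)[rule_format, of j] by (cases "i = j") auto
  qed simp
  \<comment> \<open>The interval of the complex that contains \<open>l\<close> or begins there.\<close>
  define i where "i = (GREATEST i. i \<le> n \<and> y i \<le> l)"
  have i: "i \<le> n \<and> y i \<le> l"
    unfolding i_def by (rule GreatestI_nat[of _ 0 n]) (use y(1) assms(2) in simp_all)
  then have "i < n" using y(2) assms(3) by (cases "i = n") auto
  have "\<not> y (Suc i) \<le> l"
  proof
    assume "y (Suc i) \<le> l"
    then have "Suc i \<le> (GREATEST i. i \<le> n \<and> y i \<le> l)"
      using \<open>i < n\<close> by (intro Greatest_le_nat[of _ _ n]) simp_all
    then show False by (simp add: i_def)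
  qed
  then have l: "y i \<le> l" "l < y (Suc i)" using i by auto
  have range: "0 \<le> y j" "y j < 1" if "j < n" for j
    using mono[of 0 j] mono[of j n] that y(1,2) by (cases j; auto)+
  have "{y i<..<y (Suc i)} \<inter> B = {}"
  proof (rule ccontr)
    assume "{y i<..<y (Suc i)} \<inter> B \<noteq> {}"
    then obtain j and t :: int where j: "j < n" "y i < y j + of_int t" "y j + of_int t < y (Suc i)"
      using y(4) by auto
    have "y (Suc i) \<le> 1" using mono[of "Suc i" n] \<open>i < n\<close> y(2) by (cases "Suc i = n") auto
    then have "t = 0" using j range[of i] range[of j] \<open>i < n\<close> by linarith
    then show False
      using j mono[of j i] mono[of "Suc i" j] \<open>i < n\<close> by (cases "j < i"; cases "j = i"; cases "j = Suc i") auto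
  qed
  moreover have "y i \<in> B"
  proof -
    have "y i = y i + of_int 0" by simp
    then show ?thesis unfolding y(4) using \<open>i < n\<close> by blast
  qed
  moreover have "y (Suc i) \<in> B"
  proof (cases "Suc i = n")
    case True
    then have "y (Suc i) = y 0 + of_int 1" "0 < n" using y(1,2) by auto
    then show ?thesis unfolding y(4) by blast
  next
    case False
    then have "y (Suc i) = y (Suc i) + of_int 0" "Suc i < n" using \<open>i < n\<close> by auto
    then show ?thesis unfolding y(4) by blast
  qed
  ultimately have "{y i..y (Suc i)} \<in> polyhedral_complex B"
    using mono[of i "Suc i"] \<open>i < n\<close> by (auto simp: polyhedral_complex_def interval_faces_def)
  then have "continuous_on {y i<..<y (Suc i)} g"
    using B(2) mono[of i "Suc i"] \<open>i < n\<close> by (metis lessI rel_interior_real_box Suc_leI)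
  then have "continuous_on {l<..<y (Suc i)} g"
    by (rule continuous_on_subset) (use l in auto)
  then show thesis using that l by blast
qed

lemma piecewise_linear_imp_continuous: "piecewise_linear g \<Longrightarrow> piecewise_continuous g"
proof -
  have "continuous_on S g" if "\<forall>x \<in> S. g x = m * x + c" for S and m c :: real
    using continuous_on_cong[of S S g "\<lambda>x. m * x + c"] that by (auto intro!: continuous_intros)
  then show "piecewise_linear g \<Longrightarrow> piecewise_continuous g"
    unfolding piecewise_linear_def piecewise_continuous_def by metis
qed

section \<open>Translations under which the function is additive\<close>

lemma perturbation_zero: "perturbation (\<lambda>_. 0)"
  by standard simp_all

lemma minimal_valid_pi: "minimal_valid (4/5) pi_fun"
  using perturbation.minimal_valid_perturbed[OF perturbation_zero] by simp

text \<open>Near 0, \<open>\<pi>\<close> is given by four affine pieces, two on each side. A chart consists of the ends of such a piece, its constant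
term and 11999 times its slope. A number of relations \<open>\<pi>(e + t) = \<pi>(e) + \<pi>(t)\<close> hold for a breakpoint \<open>e\<close> and all \<open>t\<close> for
which \<open>e + t\<close> ranges over a whole face; the next two predicates check this in coordinates, for an interval and for a
breakpoint respectively.\<close>

type_synonym chart = "coord \<times> coord \<times> coord \<times> int"

fun pi_on_chart :: "chart \<Rightarrow> bool" where
  "pi_on_chart (lo, hi, \<alpha>, n) \<longleftrightarrow>
     (\<forall>t. real_of_coord lo < t \<longrightarrow> t < real_of_coord hi \<longrightarrow>
        11999 * pi_fun t = 11999 * real_of_coord \<alpha> + of_int n * t)"

fun segment_shift_ok :: "int \<Rightarrow> chart \<Rightarrow> int \<Rightarrow> bool" where
  "segment_shift_ok k (lo, hi, \<alpha>, n) j = (case (row k, row j, row (j + 1)) of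
     ((e, _, w, _), (x, _, _, r), (x', l', _, _)) \<Rightarrow>
       cle lo (ccomb 1 x 1 e) \<and> cle (ccomb 1 x' 1 e) hi \<and>
       ccomb 11999 l' 11999 r = ccomb n x' n x \<and>
       ccomb 11999 r 11999 (cadd w \<alpha>) = ccomb n x n e)"

fun point_shift_ok :: "int \<Rightarrow> chart \<Rightarrow> int \<Rightarrow> bool" where
  "point_shift_ok k (lo, hi, \<alpha>, n) j = (case (row k, row j) of
     ((e, _, w, _), (x, _, v, _)) \<Rightarrow>
       clt lo (ccomb 1 x 1 e) \<and> clt (ccomb 1 x 1 e) hi \<and>
       ccomb 11999 v 11999 (cadd w \<alpha>) = ccomb n x n e)"

lemma row_real:
  assumes "row (int i) = (x, l, v, r)" "i < 41"
  shows "pi_table ! i = (real_of_coord x, real_of_coord l, real_of_coord v, real_of_coord r)"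
    and "breakpt i = real_of_coord x" and "pi_fun (breakpt i) = real_of_coord v"
  using assms pi_row[of i] pi_breakpoint[of i] by (simp_all add: row_def breakpt_def breakpt_value_def del: real_of_coord.simps)

lemma segment_shift:
  assumes ok: "segment_shift_ok (int k) (lo, hi, \<alpha>, n) (int j)" and chart: "pi_on_chart (lo, hi, \<alpha>, n)"
    and kj: "k < 41" "j < 40" and y: "breakpt j < y" "y < breakpt (Suc j)"
  shows "real_of_coord lo < y - breakpt k \<and> y - breakpt k < real_of_coord hi \<and> pi_fun y = pi_fun (breakpt k) + pi_fun (y - breakpt k)"
proof -
  obtain e el w er where K: "row (int k) = (e, el, w, er)" by (metis prod_cases4)
  obtain x l v r where J: "row (int j) = (x, l, v, r)" by (metis prod_cases4)
  obtain x' l' v' r' where J': "row (int j + 1) = (x', l', v', r')" by (metis prod_cases4)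
  have J'': "row (int (Suc j)) = (x', l', v', r')" using J' by (simp add: add.commute)
  note k = row_real[OF K kj(1)]
  have j: "pi_table ! j = (real_of_coord x, real_of_coord l, real_of_coord v, real_of_coord r)" "breakpt j = real_of_coord x"
    using row_real[OF J] kj(2) by auto
  have j': "pi_table ! Suc j = (real_of_coord x', real_of_coord l', real_of_coord v', real_of_coord r')"
    "breakpt (Suc j) = real_of_coord x'"
    using row_real[OF J''] kj(2) by auto
  have c: "cle lo (ccomb 1 x 1 e)" "cle (ccomb 1 x' 1 e) hi"
    "real_of_coord (ccomb 11999 l' 11999 r) = real_of_coord (ccomb n x' n x)"
    "real_of_coord (ccomb 11999 r 11999 (cadd w \<alpha>)) = real_of_coord (ccomb n x n e)"
    using ok K J J' by (simp_all del: real_of_coord.simps)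
  have range: "real_of_coord lo < y - breakpt k" "y - breakpt k < real_of_coord hi"
    using real_of_coord_mono[OF c(1)] real_of_coord_mono[OF c(2)] y j(2) j'(2) k(2)
    by (simp_all del: real_of_coord.simps)
  let ?x = "real_of_coord x" and ?x' = "real_of_coord x'" and ?l = "real_of_coord l'" and ?r = "real_of_coord r"
  have slope: "(?l - ?r) / (?x' - ?x) = of_int n / 11999"
    using c(3) y j(2) j'(2) by (simp add: field_simps del: real_of_coord.simps)
  have "11999 * pi_fun y = 11999 * ?r + of_int n * (y - ?x)"
    using pi_between[OF kj(2) y] slope by (simp add: chord_def j j' del: real_of_coord.simps)
  moreover have "11999 * pi_fun (y - breakpt k) = 11999 * real_of_coord \<alpha> + of_int n * (y - breakpt k)"
    using chart range by (simp del: real_of_coord.simps)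
  ultimately have "11999 * pi_fun y = 11999 * (pi_fun (breakpt k) + pi_fun (y - breakpt k))"
    using c(4) k(2,3) by (simp add: algebra_simps del: real_of_coord.simps)
  then show ?thesis using range by simp
qed

lemma point_shift:
  assumes ok: "point_shift_ok (int k) (lo, hi, \<alpha>, n) (int j)" and chart: "pi_on_chart (lo, hi, \<alpha>, n)"
    and kj: "k < 41" "j < 41"
  shows "real_of_coord lo < breakpt j - breakpt k \<and> breakpt j - breakpt k < real_of_coord hi \<and> pi_fun (breakpt j) = pi_fun (breakpt k) + pi_fun (breakpt j - breakpt k)"
proof -
  obtain e el w er where K: "row (int k) = (e, el, w, er)" by (metis prod_cases4)
  obtain x l v r where J: "row (int j) = (x, l, v, r)" by (metis prod_cases4)
  note k = row_real[OF K kj(1)] and j = row_real[OF J kj(2)]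
  have c: "clt lo (ccomb 1 x 1 e)" "clt (ccomb 1 x 1 e) hi"
    "real_of_coord (ccomb 11999 v 11999 (cadd w \<alpha>)) = real_of_coord (ccomb n x n e)"
    using ok K J by (simp_all del: real_of_coord.simps)
  have range: "real_of_coord lo < breakpt j - breakpt k" "breakpt j - breakpt k < real_of_coord hi"
    using real_of_coord_strict_mono[OF c(1)] real_of_coord_strict_mono[OF c(2)] j(2) k(2)
    by (simp_all del: real_of_coord.simps)
  then have "11999 * pi_fun (breakpt j - breakpt k) = 11999 * real_of_coord \<alpha> + of_int n * (breakpt j - breakpt k)"
    using chart by (simp del: real_of_coord.simps)
  then have "11999 * pi_fun (breakpt j) = 11999 * (pi_fun (breakpt k) + pi_fun (breakpt j - breakpt k))"
    using c(3) k(2,3) j(2,3) by (simp add: algebra_simps del: real_of_coord.simps)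
  then show ?thesis using range by simp
qed

definition chart_0 :: chart where "chart_0 = (rational_coord 0, rational_coord 4697320524, rational_coord 36133234800, -59995)"
definition chart_1 :: chart where "chart_1 = (rational_coord 4697320524, rational_coord 37887367050, rational_coord 0, 32305)"
definition chart_2 :: chart where "chart_2 = (rational_coord (-4697320524), rational_coord 0, rational_coord 36133234800, 32305)"
definition chart_3 :: chart where "chart_3 = (rational_coord (-41810803476), rational_coord (-4697320524), rational_coord 0, -59995)"

lemma pi_near_0:
  "0 < t \<Longrightarrow> t < 101/5000 \<Longrightarrow> pi_fun t = 101/650 - 5 * t"
  "101/5000 < t \<Longrightarrow> t < 60153/369200 \<Longrightarrow> pi_fun t = 35/13 * t"
  "- 101/5000 < t \<Longrightarrow> t < 0 \<Longrightarrow> pi_fun t = 101/650 + 35/13 * t"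
  "- 899/5000 < t \<Longrightarrow> t < - 101/5000 \<Longrightarrow> pi_fun t = - 5 * t"
proof -
  have breakpt: "breakpt 0 = 0" "breakpt (Suc 0) = 101/5000" "breakpt 2 = 60153/369200" "breakpt 38 = 4101/5000" "breakpt 39 = 4899/5000" "breakpt 40 = 1"
    by (simp_all add: breakpt_def pi_table_def eval_nat_numeral lim_at_def cont_at_def)
  show "pi_fun t = 101/650 - 5 * t" if "0 < t" "t < 101/5000"
    using that pi_between[of 0 t] breakpt
    by (simp add: chord_def) (simp add: pi_table_def lim_at_def cont_at_def)
  show "pi_fun t = 35/13 * t" if "101/5000 < t" "t < 60153/369200"
    using that pi_between[of 1 t] breakpt
    by (simp add: chord_def eval_nat_numeral) (simp add: pi_table_def lim_at_def cont_at_def field_simps)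
  show "pi_fun t = 101/650 + 35/13 * t" if "- 101/5000 < t" "t < 0"
    using that pi_between[of 39 "t + 1"] breakpt pi_periodic[of t 1]
    by (simp add: chord_def) (simp add: pi_table_def eval_nat_numeral lim_at_def cont_at_def field_simps)
  show "pi_fun t = - 5 * t" if "- 899/5000 < t" "t < - 101/5000"
    using that pi_between[of 38 "t + 1"] breakpt pi_periodic[of t 1]
    by (simp add: chord_def) (simp add: pi_table_def eval_nat_numeral lim_at_def cont_at_def field_simps)
qed

lemma charts_pi: "pi_on_chart chart_0" "pi_on_chart chart_1" "pi_on_chart chart_2" "pi_on_chart chart_3"
  by (auto simp: pi_near_0 chart_0_def chart_1_def chart_2_def chart_3_def denom_def simp del: real_of_coord.simps rational_coord.simps)

text \<open>An entry \<open>(k, c, j)\<close> reaches the interval after breakpoint \<open>j\<close> from breakpoint \<open>k\<close> with increments in the chart \<open>c\<close>. The intervals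
0 and 1 are charts themselves, so that with 2 to 16 every interval between 0 and \<open>l\<close> is reached.\<close>

definition segment_moves :: "(int \<times> chart \<times> int) list" where
  "segment_moves =
    [(6, chart_3, 2), (6, chart_2, 3), (10, chart_3, 4), (10, chart_2, 5), (10, chart_2, 6), (13, chart_3, 7),
     (13, chart_2, 8), (6, chart_0, 9), (6, chart_0, 10), (6, chart_1, 11), (10, chart_0, 12), (10, chart_0, 13),
     (10, chart_1, 14), (13, chart_0, 15), (13, chart_1, 16)]"

text \<open>The same for single breakpoints. The relations are read in both directions: some determine the value at \<open>j\<close> from the one
at \<open>k\<close>, others the value at \<open>k\<close> from the one at \<open>j\<close>. Breakpoint 9 is reached twice, from 6 and from 13; comparing
the two ways forces the slope to vanish.\<close>

definition point_moves :: "(int \<times> chart \<times> int) list" where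
  "point_moves =
    [(6, chart_3, 2), (6, chart_2, 4), (6, chart_2, 5), (6, chart_0, 8), (6, chart_0, 9), (13, chart_2, 9),
     (6, chart_1, 12), (6, chart_1, 14), (13, chart_1, 17), (10, chart_3, 4), (10, chart_2, 7), (10, chart_1, 15),
     (3, chart_1, 7), (11, chart_1, 15), (16, chart_1, 17)]"

lemma segment_moves_ok: "list_all (\<lambda>(k, c, j). segment_shift_ok k c j) segment_moves"
  by code_simp

lemma point_moves_ok: "list_all (\<lambda>(k, c, j). point_shift_ok k c j) point_moves"
  by code_simp

section \<open>Rigidity outside and inside the special intervals\<close>

text \<open>The property that a function carrying positive weight in a convex combination inherits.\<close>

locale tight =
  fixes h :: "real \<Rightarrow> real"
  assumes valid: "minimal_valid (4/5) h"
    and tight: "pi_fun (x + y) = pi_fun x + pi_fun y \<Longrightarrow> h (x + y) = h x + h y"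
begin

definition p :: "real \<Rightarrow> real" where "p x = h x - pi_fun x"

lemma p_add: "pi_fun (x + y) = pi_fun x + pi_fun y \<Longrightarrow> p (x + y) = p x + p y"
  using tight[of x y] by (simp add: p_def)

lemma p_periodic: "p (x + of_int k) = p x"
  using valid pi_periodic by (simp add: p_def minimal_valid_def Z_periodic_def)

lemma p_odd: "p (4/5 - x) = - p x"
  using valid pi_reflect[of x] unfolding minimal_valid_def p_def by (smt (verit))

lemma p_bounded: "\<bar>p x\<bar> \<le> 1"
proof -
  have "h x \<in> {0..1}" "pi_fun x \<in> {0..1}"
    using valid minimal_valid_pi unfolding minimal_valid_def by blast+
  then show ?thesis by (auto simp: p_def)
qed

abbreviation a :: real where "a \<equiv> 101/5000"
abbreviation b :: real where "b \<equiv> 60153/369200"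
abbreviation c :: real where "c \<equiv> 899/5000"

text \<open>Additivity makes \<open>p\<close> linear on this interval, and the interval is symmetric under \<open>x \<mapsto> 4/5 - x\<close> modulo 1, which has the
fixed point \<open>-1/10\<close>. There an odd function is 0, so the slope is 0.\<close>

lemma p_chart_3: "- c < t \<Longrightarrow> t < - a \<Longrightarrow> p t = 0"
proof -
  obtain s where s: "\<And>x. a < x \<Longrightarrow> x < c \<Longrightarrow> p (- x) = s * x"
  proof (rule bounded_additive_on_interval_linear[of a c "\<lambda>x. p (- x)" 1])
    fix x y assume xy: "a < x" "a < y" "x + y < c"
    have "pi_fun (- x) = 5 * x" "pi_fun (- y) = 5 * y" "pi_fun (- x + - y) = 5 * (x + y)"
      using pi_near_0(4)[of "- x"] pi_near_0(4)[of "- y"] pi_near_0(4)[of "- x + - y"] xy by auto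
    then show "p (- (x + y)) = p (- x) + p (- y)" using p_add[of "- x" "- y"] by simp
  qed (use p_bounded in auto)
  have "p (- (1/10)) = - p (4/5 + 1/10)" using p_odd[of "- (1/10)"] by simp
  also have "p (4/5 + 1/10) = p (- (1/10))" using p_periodic[of "- (1/10)" 1] by simp
  finally have "s = 0" using s[of "1/10"] by simp
  then show "p t = 0" if "- c < t" "t < - a" using s[of "- t"] that by simp
qed

definition \<kappa> :: real where "\<kappa> = p (- a)"

lemma pi_at: "pi_fun (101/5000) = 2727/13000" "pi_fun (- 101/5000) = 3333/13000"
  "pi_fun (60153/369200) = 421071 / 959920" "pi_fun (269/800) = 683/2080" "pi_fun (14199/64600) = 50943/167960"
proof -
  have breakpt: "breakpt 1 = 101/5000" "breakpt 2 = 60153/369200" "breakpt 39 = 4899/5000" "breakpt 18 = 269/800" "breakpt 13 = 14199/64600"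
    by (simp_all add: breakpt_def pi_table_def eval_nat_numeral lim_at_def cont_at_def)
  have breakpt_value: "breakpt_value 1 = 2727/13000" "breakpt_value 2 = 421071 / 959920" "breakpt_value 39 = 3333/13000" "breakpt_value 18 = 683/2080" "breakpt_value 13 = 50943/167960"
    by (simp_all add: breakpt_value_def pi_table_def eval_nat_numeral lim_at_def cont_at_def)
  show "pi_fun (101/5000) = 2727/13000" "pi_fun (60153/369200) = 421071 / 959920" "pi_fun (269/800) = 683/2080"
    "pi_fun (14199/64600) = 50943/167960"
    using pi_breakpoint[of 1] pi_breakpoint[of 2] pi_breakpoint[of 18] pi_breakpoint[of 13] unfolding breakpt breakpt_value by simp_all
  show "pi_fun (- 101/5000) = 3333/13000"
    using pi_breakpoint[of 39] pi_periodic[of "- 101/5000" 1] unfolding breakpt breakpt_value by simp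
qed

lemma p_chart_0: "0 < t \<Longrightarrow> t < a \<Longrightarrow> p t = \<kappa>"
proof -
  assume t: "0 < t" "t < a"
  have "pi_fun (t + (- a - t)) = pi_fun t + pi_fun (- a - t)"
    using t pi_near_0(1)[of t] pi_near_0(4)[of "- a - t"] pi_at(2) by simp
  from p_add[OF this] show "p t = \<kappa>" using p_chart_3[of "- a - t"] t by (simp add: \<kappa>_def)
qed

lemma p_a: "p a = 2 * \<kappa>"
proof -
  have "pi_fun (a / 2 + a / 2) = pi_fun (a / 2) + pi_fun (a / 2)"
    using pi_near_0(1)[of "a / 2"] pi_at(1) by simp
  from p_add[OF this] show ?thesis using p_chart_0[of "a / 2"] by simp
qed

lemma ex_slope: "\<exists>s. \<forall>t. a < t \<longrightarrow> t < b \<longrightarrow> p t = s * t"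
proof -
  obtain s where s: "\<And>x. a < x \<Longrightarrow> x < b \<Longrightarrow> p x = s * x"
  proof (rule bounded_additive_on_interval_linear[of a b p 1])
    fix x y assume xy: "a < x" "a < y" "x + y < b"
    have "pi_fun (x + y) = pi_fun x + pi_fun y"
      using pi_near_0(2)[of x] pi_near_0(2)[of y] pi_near_0(2)[of "x + y"] xy by simp
    then show "p (x + y) = p x + p y" by (rule p_add)
  qed (use p_bounded in auto)
  then show ?thesis by blast
qed

definition s :: real where "s = (SOME s. \<forall>t. a < t \<longrightarrow> t < b \<longrightarrow> p t = s * t)"

lemma p_chart_1: "a < t \<Longrightarrow> t < b \<Longrightarrow> p t = s * t"
  using someI_ex[OF ex_slope] unfolding s_def by blast

text \<open>The relation at \<open>a = (a - t) + t\<close> expresses \<open>p\<close> by \<open>\<kappa>\<close> and \<open>s\<close>; the relation \<open>-a = -a/2 - a/2\<close> then gives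
\<open>\<kappa> = s a\<close>.\<close>

lemma p_chart_2: "- a < t \<Longrightarrow> t < 0 \<Longrightarrow> p t = \<kappa> + s * t"
proof -
  have *: "p t = 2 * \<kappa> - s * (a - t)" if t: "- a < t" "t < 0" for t
  proof -
    have "pi_fun ((a - t) + t) = pi_fun (a - t) + pi_fun t"
      using t pi_near_0(2)[of "a - t"] pi_near_0(3)[of t] pi_at(1) by (simp add: field_simps)
    from p_add[OF this] show ?thesis using p_chart_1[of "a - t"] p_a t by simp
  qed
  have "pi_fun (- a / 2 + - a / 2) = pi_fun (- a / 2) + pi_fun (- a / 2)"
    using pi_near_0(3)[of "- a / 2"] pi_at(2) by simp
  from p_add[OF this] have "\<kappa> = s * a" using *[of "- a / 2"] by (simp add: \<kappa>_def)
  then show "p t = \<kappa> + s * t" if "- a < t" "t < 0" using *[OF that] by (simp add: algebra_simps)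
qed

lemma p_b: "p b = s * b"
proof -
  have "pi_fun (b / 2 + b / 2) = pi_fun (b / 2) + pi_fun (b / 2)"
    using pi_near_0(2)[of "b / 2"] pi_at(3) by simp
  from p_add[OF this] show ?thesis using p_chart_1[of "b / 2"] by simp
qed

lemma pi_segment_18: "269/800 < y \<Longrightarrow> y < 371/800 \<Longrightarrow> pi_fun y = 683/2080 + 35/13 * (y - 269/800)"
proof -
  have breakpt: "breakpt 18 = 269/800" "breakpt 19 = 371/800"
    by (simp_all add: breakpt_def pi_table_def eval_nat_numeral lim_at_def cont_at_def)
  show "pi_fun y = 683/2080 + 35/13 * (y - 269/800)" if "269/800 < y" "y < 371/800"
    using that pi_between[of 18 y] breakpt by (simp add: chord_def pi_table_def eval_nat_numeral lim_at_def cont_at_def)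
qed

text \<open>The move from breakpoint \<open>269/800\<close> gives a linear function with the right slope; the constant comes from oddness, since
\<open>2/5\<close> is fixed by \<open>x \<mapsto> 4/5 - x\<close>.\<close>

lemma p_segment_18: "269/800 + a < y \<Longrightarrow> y < 371/800 \<Longrightarrow> p y = s * (y - 2/5)"
proof -
  have *: "p y = p (269/800) + s * (y - 269/800)" if y: "269/800 + a < y" "y < 371/800" for y
  proof -
    define d where "d = y - 269/800"
    have d: "a < d" "d < 102/800" using y by (auto simp: d_def)
    then have "pi_fun (269/800 + d) = pi_fun (269/800) + pi_fun d"
      using pi_segment_18[of "269/800 + d"] pi_near_0(2)[of d] pi_at(4) by simp
    from p_add[OF this] show ?thesis using p_chart_1[of d] d by (simp add: d_def)
  qed
  have "p (2/5) = 0" using p_odd[of "2/5"] by simp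
  then have "p (269/800) = s * (269/800 - 2/5)" using *[of "2/5"] by (simp add: algebra_simps)
  then show "p y = s * (y - 2/5)" if "269/800 + a < y" "y < 371/800"
    using *[OF that] by (simp add: algebra_simps)
qed

lemma p_269: "p (269/800) = s * (269/800 - 2/5)"
proof -
  have "pi_fun (269/800 + 51/800) = pi_fun (269/800) + pi_fun (51/800)"
    using pi_segment_18[of "2/5"] pi_near_0(2)[of "51/800"] pi_at(4) by simp
  from p_add[OF this] show ?thesis
    using p_chart_1[of "51/800"] p_odd[of "2/5"] by simp
qed

lemma p_x13: "p (14199/64600) = s * (14199/64600 - 1/5)"
proof -
  have "pi_fun (14199/64600 + 14199/64600) = pi_fun (14199/64600) + pi_fun (14199/64600)"
    using pi_segment_18[of "14199/32300"] pi_at(5) by simp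
  from p_add[OF this] show ?thesis
    using p_segment_18[of "14199/32300"] by (simp add: algebra_simps)
qed

definition on_chart :: "chart \<Rightarrow> real \<Rightarrow> bool" where
  "on_chart = (\<lambda>(lo, hi, \<alpha>, n) t. real_of_coord lo < t \<and> t < real_of_coord hi)"

lemma on_chart_simps:
  "on_chart chart_0 t \<longleftrightarrow> 0 < t \<and> t < a"
  "on_chart chart_1 t \<longleftrightarrow> a < t \<and> t < b"
  "on_chart chart_2 t \<longleftrightarrow> - a < t \<and> t < 0"
  "on_chart chart_3 t \<longleftrightarrow> - c < t \<and> t < - a"
  by (simp_all add: on_chart_def chart_0_def chart_1_def chart_2_def chart_3_def denom_def
    del: real_of_coord.simps rational_coord.simps)

lemma p_point_shift:
  assumes "point_shift_ok (int k) ch (int j)" "pi_on_chart ch" "k < 41" "j < 41"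
  shows "on_chart ch (breakpt j - breakpt k) \<and> p (breakpt j) = p (breakpt k) + p (breakpt j - breakpt k)"
proof -
  obtain lo hi \<alpha> n where ch: "ch = (lo, hi, \<alpha>, n)" by (metis prod_cases4)
  from point_shift[OF assms(1)[unfolded ch] assms(2)[unfolded ch] assms(3,4)]
  show ?thesis using p_add[of "breakpt k" "breakpt j - breakpt k"] by (simp add: on_chart_def ch)
qed

lemma p_segment_shift:
  assumes "segment_shift_ok (int k) ch (int j)" "pi_on_chart ch" "k < 41" "j < 40" "breakpt j < y" "y < breakpt (Suc j)"
  shows "on_chart ch (y - breakpt k) \<and> p y = p (breakpt k) + p (y - breakpt k)"
proof -
  obtain lo hi \<alpha> n where ch: "ch = (lo, hi, \<alpha>, n)" by (metis prod_cases4)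
  from segment_shift[OF assms(1)[unfolded ch] assms(2)[unfolded ch] assms(3-6)]
  show ?thesis using p_add[of "breakpt k" "y - breakpt k"] by (simp add: on_chart_def ch)
qed

lemma breakpt_values: "breakpt 0 = 0" "breakpt (Suc 0) = a" "breakpt 2 = b" "breakpt 6 = 19/100" "breakpt 9 = 36999/184600" "breakpt 13 = 14199/64600"
  "breakpt 17 = 219/800" "breakpt 18 = 269/800" "breakpt 19 = 371/800"
  by (simp_all add: breakpt_def pi_table_def eval_nat_numeral lim_at_def cont_at_def)

text \<open>Two ways of computing \<open>p\<close> at breakpoint 9 give \<open>s (b - x\<^sub>9 + 1/5) = 0\<close>, where \<open>x\<^sub>9\<close> is that breakpoint.\<close>

lemma slope_0: "s = 0"
proof -
  have ok: "point_shift_ok (int 6) chart_3 (int 2)" "point_shift_ok (int 6) chart_0 (int 9)"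
    "point_shift_ok (int 13) chart_2 (int 9)"
    using point_moves_ok by (simp_all add: point_moves_def)
  have x13: "p (breakpt 13) = s * (breakpt 13 - 1/5)" using p_x13 by (simp only: breakpt_values(6))
  have "p b = p (breakpt 6)"
    using p_point_shift[OF ok(1) charts_pi(4)] p_chart_3 breakpt_values(3) by (auto simp: on_chart_simps)
  moreover have "p (breakpt 9) = p (breakpt 6) + \<kappa>"
    using p_point_shift[OF ok(2) charts_pi(1)] p_chart_0 by (auto simp: on_chart_simps)
  moreover have "p (breakpt 9) = p (breakpt 13) + (\<kappa> + s * (breakpt 9 - breakpt 13))"
    using p_point_shift[OF ok(3) charts_pi(3)] p_chart_2 by (auto simp: on_chart_simps)
  ultimately have "s * b = s * (breakpt 13 - 1/5) + s * (breakpt 9 - breakpt 13)"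
    using p_b x13 by linarith
  then have "s * (b - (breakpt 9 - 1/5)) = 0" by (simp add: algebra_simps)
  moreover have "b - (breakpt 9 - 1/5) \<noteq> 0" by (simp add: breakpt_values)
  ultimately show ?thesis by simp
qed

lemma kappa_0: "\<kappa> = 0"
  using p_chart_2[of "- a / 2"] p_add[of "- a / 2" "- a / 2"] pi_near_0(3)[of "- a / 2"] pi_at(2) slope_0
  by (simp add: \<kappa>_def)

lemma p_charts: "ch \<in> {chart_0, chart_1, chart_2, chart_3} \<Longrightarrow> on_chart ch t \<Longrightarrow> p t = 0"
  using p_chart_0 p_chart_1 p_chart_2 p_chart_3 slope_0 kappa_0 by (auto simp: on_chart_simps)

lemma p_point_shift_0:
  assumes "point_shift_ok (int k) ch (int j)" "ch \<in> {chart_0, chart_1, chart_2, chart_3}" "k < 41" "j < 41"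
  shows "p (breakpt j) = p (breakpt k)"
  using p_point_shift[OF assms(1) _ assms(3,4)] p_charts[OF assms(2)] assms(2) charts_pi by auto

lemma p_segment_shift_0:
  assumes "segment_shift_ok (int k) ch (int j)" "ch \<in> {chart_0, chart_1, chart_2, chart_3}" "k < 41" "j < 40"
    "breakpt j < y" "y < breakpt (Suc j)"
  shows "p y = p (breakpt k)"
  using p_segment_shift[OF assms(1) _ assms(3-6)] p_charts[OF assms(2)] assms(2) charts_pi by auto

text \<open>The order of the steps matters: first the targets of the known breakpoints 6 and 13, from them breakpoint 10 and its
targets, and finally the breakpoints 3, 11 and 16, which are sources of relations with known targets.\<close>

lemma p_points: "j \<le> 18 \<Longrightarrow> p (breakpt j) = 0"
proof -
  have eq: "p (breakpt j) = p (breakpt k)"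
    if "(int k, ch, int j) \<in> set point_moves" for k ch j
    using point_moves_ok that by (intro p_point_shift_0[where ch = ch]) (auto simp: list_all_iff point_moves_def)
  have 13: "p (breakpt 13) = 0" using p_x13 slope_0 by (simp only: breakpt_values(6) mult_zero_left)
  note mv = eq[unfolded point_moves_def]
  have 2: "p (breakpt 2) = 0" using p_b slope_0 by (simp only: breakpt_values(3) mult_zero_left)
  have 6: "p (breakpt 6) = 0" using mv[of 6 chart_3 2] 2 by simp
  have 4: "p (breakpt 4) = 0" "p (breakpt 5) = 0" "p (breakpt 8) = 0" "p (breakpt 9) = 0" "p (breakpt 12) = 0" "p (breakpt 14) = 0"
    using mv[of 6 chart_2 4] mv[of 6 chart_2 5] mv[of 6 chart_0 8] mv[of 6 chart_0 9]
      mv[of 6 chart_1 12] mv[of 6 chart_1 14] 6 by simp_all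
  have 10: "p (breakpt 10) = 0" using mv[of 10 chart_3 4] 4 by simp
  have 7: "p (breakpt 7) = 0" "p (breakpt 15) = 0" "p (breakpt 17) = 0"
    using mv[of 10 chart_2 7] mv[of 10 chart_1 15] mv[of 13 chart_1 17] 10 13 by simp_all
  have 3: "p (breakpt 3) = 0" "p (breakpt 11) = 0" "p (breakpt 16) = 0"
    using mv[of 3 chart_1 7] mv[of 11 chart_1 15] mv[of 16 chart_1 17] 7 by simp_all
  have "p 0 = 0" using p_add[of 0 0] minimal_valid_pi by (simp add: minimal_valid_def)
  then have 0: "p (breakpt 0) = 0" by (simp only: breakpt_values(1))
  have 1: "p (breakpt 1) = 0" using p_a kappa_0 by (simp only: One_nat_def breakpt_values(2) mult_zero_right)
  have 18: "p (breakpt 18) = 0" using p_269 slope_0 by (simp only: breakpt_values(8) mult_zero_left)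
  show "p (breakpt j) = 0" if "j \<le> 18"
  proof -
    have "j \<in> {0, 1, 2, 3, 4, 5, 6, 7, 8, 9, 10, 11, 12, 13, 14, 15, 16, 17, 18}"
      using that by (simp only: insert_iff empty_iff simp_thms) presburger
    then show ?thesis using 0 1 2 3 4 6 7 10 13 18 by (elim insertE emptyE) (simp_all only:)
  qed
qed

lemma p_segments:
  assumes "j < 17" "breakpt j < y" "y < breakpt (Suc j)"
  shows "p y = 0"
proof -
  have eq: "p y = 0"
    if "(int k, ch, int j) \<in> set segment_moves" for k ch
  proof -
    have "p y = p (breakpt k)"
      using segment_moves_ok that assms(2,3)
      by (intro p_segment_shift_0[where ch = ch]) (auto simp: list_all_iff segment_moves_def)
    moreover have "k \<le> 18" using that by (auto simp: segment_moves_def)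
    ultimately show ?thesis using p_points by simp
  qed
  consider "j = 0" | "j = 1" | "2 \<le> j" by linarith
  then show ?thesis
  proof cases
    case 1
    then show ?thesis using p_chart_0 kappa_0 assms breakpt_values by simp
  next
    case 2
    then show ?thesis using p_chart_1 slope_0 assms breakpt_values by (simp add: eval_nat_numeral)
  next
    case 3
    then have "j \<in> {2, 3, 4, 5, 6, 7, 8, 9, 10, 11, 12, 13, 14, 15, 16}"
      using assms(1) by (simp only: insert_iff empty_iff simp_thms) presburger
    then show ?thesis
      using eq[of 6 chart_3] eq[of 6 chart_2] eq[of 10 chart_3] eq[of 10 chart_2] eq[of 13 chart_3] eq[of 13 chart_2]
        eq[of 6 chart_0] eq[of 6 chart_1] eq[of 10 chart_0] eq[of 10 chart_1] eq[of 13 chart_0] eq[of 13 chart_1]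
      unfolding segment_moves_def by (elim insertE emptyE) simp_all
  qed
qed

lemma p_left_half:
  assumes "0 \<le> y" "y \<le> 2/5" "y \<notin> face 35"
  shows "p y = 0"
proof -
  have "0 \<le> y" "y \<le> 1" using assms by auto
  then show ?thesis
  proof (cases rule: pi_position)
    case (breakpoint i)
    then have "i < 19" using breakpt_mono[of i 19] breakpt_values assms by auto
    then show ?thesis using p_points breakpoint by simp
  next
    case (between i)
    then have "i < 19" using breakpt_mono[of i 19] breakpt_values assms by auto
    then consider "i < 17" | "i = 17" | "i = 18" by linarith
    then show ?thesis
    proof cases
      case 1
      then show ?thesis using p_segments between by simp
    next
      case 2
      then have "y \<in> face 35" using between breakpt_values by (simp add: face_def)
      then show ?thesis using assms by simp
    next
      case 3
      then have y: "269/800 < y" "y < 371/800" using between breakpt_values by (simp_all add: eval_nat_numeral)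
      show ?thesis
      proof (cases "269/800 + a < y")
        case True
        then show ?thesis using p_segment_18 y slope_0 by simp
      next
        case False
        then have "p (4/5 - y) = 0" using p_segment_18[of "4/5 - y"] y slope_0 by simp
        then show ?thesis using p_odd[of y] by simp
      qed
    qed
  qed
qed

text \<open>The reflection \<open>x \<mapsto> 4/5 - x\<close> maps \<open>[0, 4/5]\<close> and, modulo 1, \<open>[4/5, 1]\<close> to themselves, so half of each suffices.\<close>

lemma p_off_special:
  assumes "0 \<le> y" "y < 1" "y \<notin> face 35" "y \<notin> face 39"
  shows "p y = 0"
proof -
  consider "y \<le> 2/5" | "2/5 < y" "y \<le> 4/5" | "4/5 < y" by linarith
  then show ?thesis
  proof cases
    case 1
    then show ?thesis using p_left_half assms by simp
  next
    case 2
    then have "4/5 - y \<notin> face 35" using assms by (auto simp: special_faces)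
    then have "p (4/5 - y) = 0" using p_left_half 2 by simp
    then show ?thesis using p_odd[of y] by simp
  next
    case 3
    have neg: "p t = 0" if "- c < t" "t < 0" for t
    proof -
      consider "t = - a" | "- a < t" | "t < - a" by linarith
      then show ?thesis
        by cases (use p_chart_2[of t] p_chart_3[of t] kappa_0 slope_0 that \<kappa>_def in simp_all)
    qed
    have per: "p y = p (y - 1)" using p_periodic[of "y - 1" 1] by simp
    show ?thesis
    proof (cases "- c < y - 1")
      case True
      then show ?thesis using neg assms per by simp
    next
      case False
      then have "p (4/5 - y) = 0" using neg[of "4/5 - y"] 3 by simp
      then show ?thesis using p_odd[of y] by simp
    qed
  qed
qed

lemma p_swap:
  assumes "e \<in> swap_points" "y \<in> face 35" "z \<in> face 35" "e + y + z = 4/5"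
  shows "p y + p z = 0"
proof -
  have ey: "e + y = 4/5 - z" using assms(4) by simp
  have "pi_fun (e + y) = pi_fun e + pi_fun y"
    unfolding ey using swap_additive[OF assms] pi_reflect[of z] by linarith
  moreover have "p e = 0" using assms(1) p_points unfolding swap_points_table by auto
  ultimately show ?thesis using p_add[of e y] p_odd[of z] ey by simp
qed

text \<open>Two reflections compose to a translation: both \<open>y\<close> and \<open>y + t\<close> are reflected to \<open>61/100 - (y + t)\<close>, with the
points \<open>19/100 + t\<close> and \<open>19/100\<close>.\<close>

lemma p_translate:
  assumes "t \<in> {77/7752 * sqrt 2, 77/2584}" "219/800 < y" "y + t < 269/800"
  shows "p (y + t) = p y"
proof -
  have t: "0 < t" using assms(1) by (elim insertE emptyE; hypsubst; simp)
  have e: "19/100 \<in> swap_points" "19/100 + t \<in> swap_points" using assms(1) by (auto simp: swap_points_def)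
  let ?z = "61/100 - (y + t)"
  have mem: "y \<in> face 35" "y + t \<in> face 35" "?z \<in> face 35" using assms t by (auto simp: special_faces)
  show ?thesis using p_swap[OF e(2) mem(1,3)] p_swap[OF e(1) mem(2,3)] by simp
qed

lemma p_orbit:
  assumes "x \<in> face 35" "y \<in> face 35" "y - x \<in> shift_group"
  shows "p y = p x"
proof -
  obtain i j where y: "y = x + of_int i * (77/7752 * sqrt 2) + of_int j * (77/2584)"
    using assms(3) by (auto simp: shift_group_def algebra_simps)
  have "sqrt 2 < 10 / 7" by (rule real_less_lsqrt) (simp_all add: power2_eq_square)
  then have "77/7752 * sqrt 2 + 77/2584 < 269/800 - 219/(800::real)" by simp
  from invariant_under_steps[OF _ _ this, of p x i j] show ?thesis
    using assms(1,2) p_translate unfolding y by (auto simp: special_faces)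
qed

text \<open>Piecewise continuity is used at a single point \<open>m\<close> of \<open>(l, u)\<close> only: every orbit of the dense group accumulates there, so
\<open>p\<close> takes the value \<open>p m\<close> on all of \<open>(l, u)\<close>.\<close>

lemma tight_continuous_eq:
  assumes "piecewise_continuous h"
  shows "h = pi_fun"
proof -
  obtain d0 where d0: "219/800 < d0" "continuous_on {219/800<..<d0} h"
    using piecewise_continuous_right[OF assms, of "219/800"] by auto
  define d where "d = min d0 (269/800)"
  define m where "m = (219/800 + d) / 2"
  have d: "219/800 < d" "d \<le> 269/800" "d \<le> d0" using d0 by (auto simp: d_def)
  have m: "219/800 < m" "m < d" using d by (auto simp: m_def)
  have sub: "{219/800<..<d} \<subseteq> face 35" using d by (auto simp: special_faces)
  have "continuous_on {219/800<..<d} h" by (rule continuous_on_subset[OF d0(2)]) (use d in auto)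
  moreover have "continuous_on {219/800<..<d} pi_fun"
  proof (rule continuous_on_eq)
    show "continuous_on {219/800<..<d} (\<lambda>y. 51443 / 147680 + 5 / 11999 * (y - 219/800))"
      by (intro continuous_intros)
    show "51443 / 147680 + 5 / 11999 * (y - 219/800) = pi_fun y" if "y \<in> {219/800<..<d}" for y
      using pi_on_special[of y] sub that by auto
  qed
  ultimately have "continuous_on {219/800<..<d} p"
    unfolding p_def[abs_def] by (intro continuous_on_diff)
  then have "isCont p m" using m by (simp add: continuous_on_eq_continuous_at)
  have const: "p x = p m" if x: "x \<in> face 35" for x
  proof (rule ccontr)
    assume "p x \<noteq> p m"
    then have "0 < \<bar>p x - p m\<bar>" by simp
    then obtain \<delta> where \<delta>: "0 < \<delta>" "\<And>y. \<bar>y - m\<bar> < \<delta> \<Longrightarrow> \<bar>p y - p m\<bar> < \<bar>p x - p m\<bar>"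
      using \<open>isCont p m\<close> unfolding continuous_at_eps_delta dist_real_def by metis
    define r where "r = min \<delta> (min (m - 219/800) (d - m))"
    have "0 < r" using \<delta>(1) m by (auto simp: r_def)
    then obtain t where t: "t \<in> shift_group" "\<bar>t - (m - x)\<bar> < r" by (rule shift_group_dense)
    have "x + t \<in> face 35" using t(2) d(2) by (auto simp: r_def special_faces)
    then have "p (x + t) = p x" using t(1) x by (intro p_orbit) auto
    moreover have "\<bar>(x + t) - m\<bar> < \<delta>" using t(2) by (auto simp: r_def algebra_simps)
    ultimately show False using \<delta>(2)[of "x + t"] by simp
  qed
  have p35: "p x = 0" if x: "x \<in> face 35" for x
  proof -
    have z: "61/100 - x \<in> face 35" using x by (auto simp: special_faces)
    have "p x + p (61/100 - x) = 0"
      using x z by (intro p_swap[of "19/100"]) (auto simp: swap_points_def)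
    then show ?thesis using const[OF x] const[OF z] by simp
  qed
  have p39: "p x = 0" if x: "x \<in> face 39" for x
  proof -
    have "4/5 - x \<in> face 35" using x by (auto simp: special_faces)
    then show ?thesis using p35[of "4/5 - x"] p_odd[of x] by simp
  qed
  have "p x = 0" for x
  proof -
    have "p (frac x) = 0"
      using p35 p39 p_off_special[of "frac x"] frac_lt_1[of x] frac_ge_0[of x] by blast
    then show ?thesis using p_periodic[of "frac x" "\<lfloor>x\<rfloor>"] by (simp add: frac_def)
  qed
  then show ?thesis by (auto simp: p_def)
qed

end

text \<open>The subadditivity gaps of the components are nonnegative and their weighted sum is the gap of \<open>\<pi>\<close>. So where the latter
is 0, each component with positive weight is additive as well.\<close>

lemma no_convex_combination:
  assumes "\<And>g. g \<in> C \<Longrightarrow> minimal_valid (4/5) g \<and> piecewise_continuous g \<and> g \<noteq> pi_fun"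
  shows "\<not> convex_combination_of pi_fun C"
proof
  assume "convex_combination_of pi_fun C"
  then obtain n and w :: "nat \<Rightarrow> real" and h where wh: "\<forall>i<n. 0 \<le> w i \<and> h i \<in> C" "(\<Sum>i<n. w i) = 1"
    "pi_fun = (\<lambda>x. \<Sum>i<n. w i * h i x)" unfolding convex_combination_of_def by blast
  have "\<exists>i<n. w i \<noteq> 0"
  proof (rule ccontr)
    assume "\<not> (\<exists>i<n. w i \<noteq> 0)"
    then have "(\<Sum>i<n. w i) = 0" by (intro sum.neutral) auto
    then show False using wh(2) by simp
  qed
  then obtain i where i: "i < n" "w i \<noteq> 0" by blast
  then have "0 < w i" using wh(1) by (simp add: order.strict_iff_order)
  have valid: "minimal_valid (4/5) (h j)" if "j < n" for j using wh(1) that assms by blast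
  have "tight (h i)"
  proof
    show "minimal_valid (4/5) (h i)" using valid i by simp
    fix x y assume eq: "pi_fun (x + y) = pi_fun x + pi_fun y"
    let ?\<Delta> = "\<lambda>j. h j x + h j y - h j (x + y)"
    have nonneg: "0 \<le> w j * ?\<Delta> j" if "j < n" for j
    proof -
      have "h j (x + y) \<le> h j x + h j y" using valid[OF that] by (simp add: minimal_valid_def)
      then show ?thesis using wh(1) that by (intro mult_nonneg_nonneg) auto
    qed
    have "(\<Sum>j<n. w j * ?\<Delta> j) = pi_fun x + pi_fun y - pi_fun (x + y)"
      unfolding wh(3) by (simp add: algebra_simps sum.distrib sum_subtractf)
    then have "(\<Sum>j<n. w j * ?\<Delta> j) = 0" using eq by simp
    then have "w i * ?\<Delta> i = 0" using sum_nonneg_eq_0_iff[of "{..<n}" "\<lambda>j. w j * ?\<Delta> j"] nonneg i by auto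
    then show "h i (x + y) = h i x + h i y" using i by simp
  qed
  then show False using tight.tight_continuous_eq[of "h i"] assms[of "h i"] wh(1) i by blast
qed

section \<open>Minimality, rigidity and failure of extremality\<close>

theorem theorem5p1:
  fixes f l u t1 t2 \<epsilon> :: real and T :: "real set" and pi_bar :: "real \<Rightarrow> real"
  assumes "f = 4 / 5" and "l = 219 / 800" and "u = 269 / 800"
    and "t1 = 77 / 7752 * sqrt 2" and "t2 = 77 / 2584"
    and "T = {of_int a * t1 + of_int b * t2 | (a::int) (b::int). True}"
    and "Z_periodic pi_bar"
    and "\<forall>x \<in> {0..<1}. pi_bar x =
          (if x \<in> {l<..<u} \<and> x - l \<in> T \<or> x \<in> {f - u<..<f - l} \<and> x - f + u \<in> T then 1
           else if x \<in> {l<..<u} \<and> x - u \<in> T \<or> x \<in> {f - u<..<f - l} \<and> x - f + l \<in> T then -1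
           else 0)"
    and "\<epsilon> = 0.0003"
  shows "minimal_valid f pi_fun \<and>
    (\<not> convex_combination_of pi_fun {g. minimal_valid f g \<and> piecewise_continuous g \<and> g \<noteq> pi_fun} \<and>
     \<not> convex_combination_of pi_fun {g. minimal_valid f g \<and> piecewise_linear g \<and> g \<noteq> pi_fun}) \<and>
    (\<not> extreme f pi_fun \<and>
     (\<exists>p. locally_microperiodic p \<and> effective_perturbation f pi_fun p) \<and>
     locally_microperiodic pi_bar \<and>
     minimal_valid f (\<lambda>x. pi_fun x + \<epsilon> * pi_bar x) \<and>
     minimal_valid f (\<lambda>x. pi_fun x - \<epsilon> * pi_bar x))"
proof -
  note params = assms(1-6,9)
  have T: "T = shift_group"
    unfolding shift_group_def assms(4-6) ..
  interpret microperiodic_bar pi_bar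
  proof
    show "Z_periodic pi_bar" by (fact assms(7))
    show "\<forall>x \<in> {0..<1}. pi_bar x =
      (if x \<in> {219/800<..<269/800} \<and> x - 219/800 \<in> shift_group \<or> x \<in> {4/5 - 269/800<..<4/5 - 219/800} \<and> x - 4/5 + 269/800 \<in> shift_group then 1
       else if x \<in> {219/800<..<269/800} \<and> x - 269/800 \<in> shift_group \<or> x \<in> {4/5 - 269/800<..<4/5 - 219/800} \<and> x - 4/5 + 219/800 \<in> shift_group then -1
       else 0)"
      using assms(8) unfolding assms(1-3) T .
  qed
  have f: "f = 4/5" and \<epsilon>: "\<epsilon> = 3/10000" using params by simp_all
  have \<epsilon>_pos: "0 < \<epsilon>" using \<epsilon> by simp
  have plus: "minimal_valid f (\<lambda>x. pi_fun x + \<epsilon> * pi_bar x)"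
    using perturbation.minimal_valid_perturbed[OF perturbation_bar[of "3/10000"]] by (simp add: f \<epsilon>)
  have minus: "minimal_valid f (\<lambda>x. pi_fun x - \<epsilon> * pi_bar x)"
    using perturbation.minimal_valid_perturbed[OF perturbation_bar[of "- 3/10000"]] by (simp add: f \<epsilon>)
  have effective: "effective_perturbation f pi_fun pi_bar"
    unfolding effective_perturbation_def using plus minus \<epsilon>_pos by blast
  have valid: "minimal_valid f pi_fun" unfolding f by (rule minimal_valid_pi)
  have not_extreme: "\<not> extreme f pi_fun"
  proof
    assume "extreme f pi_fun"
    let ?y = "219/800 + 77/2584 :: real"
    have "(\<lambda>x. pi_fun x + \<epsilon> * pi_bar x) \<noteq> pi_fun" "(\<lambda>x. pi_fun x - \<epsilon> * pi_bar x) \<noteq> pi_fun"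
      using bar_nonzero \<epsilon> by (auto dest!: fun_cong[of _ _ ?y])
    moreover have "pi_fun = (\<lambda>x. 1/2 * (pi_fun x + \<epsilon> * pi_bar x) + (1 - 1/2) * (pi_fun x - \<epsilon> * pi_bar x))"
      by (simp add: field_simps)
    moreover have "0 \<le> (1/2 :: real)" "1/2 \<le> (1 :: real)" by simp_all
    ultimately show False using \<open>extreme f pi_fun\<close> plus minus unfolding extreme_def by metis
  qed
  have "\<not> convex_combination_of pi_fun {g. minimal_valid f g \<and> piecewise_continuous g \<and> g \<noteq> pi_fun}"
    unfolding f by (rule no_convex_combination) simp
  moreover have "\<not> convex_combination_of pi_fun {g. minimal_valid f g \<and> piecewise_linear g \<and> g \<noteq> pi_fun}"
    unfolding f by (rule no_convex_combination) (simp add: piecewise_linear_imp_continuous)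
  ultimately show ?thesis
    using valid not_extreme effective locally_microperiodic_bar plus minus by blast
qed

end
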